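(* There exist absolute constants $C>0$ (sufficiently large) and $c>0$ (sufficiently small) such that the following holds. Let $T_*\in\mathcal T(s)$ with $1\le s<K$, and assume $$N\ge C\,\frac{\log(s\vee n)}{\kappa^4(A_{\underline J},s)\,T_{\min}^3}$$ (in particular $\kappa(A_{\underline J},s)>0$) and $$\left(\kappa^{-1}(A_{\underline J},s)\sqrt{\frac{\xi s}{T_{\min}}}+1\right)\sqrt{\frac{\xi\log K}{T_{\min}N}}\ \le\ c\,\min_{k\in S_*^c}\sum_{j\in\overline J^c}A_{jk}.$$ Then $$\mathbb P\left\{\mathrm{supp}(\widehat T_{\rm mle})\subseteq\mathrm{supp}(T_* )\right\}\ge 1-2p^{-1}-4(s\vee n)^{-1}-4K^{-1}.$$
   Context: Setting. $p>K\ge1$, $N\ge 1$ and $n\ge1$ are integers ($n$ is the number of documents in the corpus; it enters the statement only through the displayed formulas), $\Delta_d=\{x\in\mathbb R^d: x_j\ge 0\ \forall j,\ \sum_j x_j=1\}$, $a\vee b=\max\{a,b\}$. $A\in\mathbb R^{p\times K}$ is a known matrix whose columns belong to $\Delta_p$; $A_{j\cdot}\in\mathbb R^K$ denotes its $j$-th row (as a column vector), $A_{jS}$ its subvector with indices in $S$ and, for $U\subseteq[p]$, $A_U$ denotes the submatrix of rows in $U$. $T_*\in\Delta_K$, $\Pi_*=AT_*\in\Delta_p$, and the data $X\in\mathbb R^p$ satisfies $NX\sim\mathrm{Multinomial}_p(N;\Pi_* )$. $S_*=\mathrm{supp}(T_* )$, $S_*^c=[K]\setminus S_*$, $T_{\min}=\min_{k\in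 S_*}T_{*k}$, and $\mathcal T(s)=\{T\in\Delta_K:|\mathrm{supp}(T)|=s\}$. Estimator. $J=\{j\in[p]:X_j>0\}$ and $\widehat T_{\rm mle}\in\arg\max_{T\in\Delta_K}\sum_{j\in J}X_j\log(A_{j\cdot}^\top T)$ (any maximizer). Quantities. $\overline J=\{j:\Pi_{*j}>0\}$, $\overline J^c=[p]\setminus\overline J$; $\varepsilon_j=2\sqrt{\Pi_{*j}\log p/N}+\frac{4\log p}{3N}$; $\underline J=\{j:\Pi_{*j}>2\varepsilon_j\}$; $\xi=\max_{j\in\overline J}\|A_{jS_*^c}\|_\infty/\|A_{jS_*}\|_1$. For a matrix $M$ with $K$ columns, $$\kappa(M,s)=\min_{S\subseteq[K],\,|S|\le s}\ \min_{v\in\mathcal C(S)}\frac{\|Mv\|_1}{\|v\|_1},\qquad \mathcal C(S)=\{v\in\mathbb R^K\setminus\{0\}:\|v_S\|_1\ge\|v_{S^c}\|_1\}.$$ *)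

theory Defs
  imports "HOL-Probability.Probability" "HOL-Combinatorics.Multiset_Permutations"
begin

text \<open>
  Vectors in \<open>\<real>\<^sup>d\<close> are functions \<open>nat \<Rightarrow> real\<close> of which only the values at indices \<open>< d\<close> matter,
  and a \<open>p \<times> K\<close> matrix is a function \<open>nat \<Rightarrow> nat \<Rightarrow> real\<close> (row, then column). Indices are
  shifted to start at 0. The dimensions are not types because they are quantified inside the
  scope of the absolute constants.
\<close>

definition simplex_vecs :: "nat \<Rightarrow> (nat \<Rightarrow> real) set" where
  "simplex_vecs d = {x. (\<forall>j<d. 0 \<le> x j) \<and> (\<Sum>j<d. x j) = 1}"

definition supp :: "nat \<Rightarrow> (nat \<Rightarrow> real) \<Rightarrow> nat set" where
  "supp d x = {j. j < d \<and> x j \<noteq> 0}"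

definition mat_vec :: "nat \<Rightarrow> (nat \<Rightarrow> nat \<Rightarrow> real) \<Rightarrow> (nat \<Rightarrow> real) \<Rightarrow> nat \<Rightarrow> real" where
  "mat_vec K A v j = (\<Sum>k<K. A j k * v k)"

definition norm1_on :: "nat set \<Rightarrow> (nat \<Rightarrow> real) \<Rightarrow> real" where
  "norm1_on S v = (\<Sum>k\<in>S. \<bar>v k\<bar>)"

definition norm_inf_on :: "nat set \<Rightarrow> (nat \<Rightarrow> real) \<Rightarrow> real" where
  "norm_inf_on S v = Max ((\<lambda>k. \<bar>v k\<bar>) ` S)"

definition categorical_pmf :: "nat \<Rightarrow> (nat \<Rightarrow> real) \<Rightarrow> nat pmf" where
  "categorical_pmf p q = embed_pmf (\<lambda>j. if j < p then q j else 0)"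

text \<open>Joint law of the category counts of \<open>N\<close> i.i.d. categorical draws; the usual mass
  function is derived below.\<close>

definition multinomial_pmf :: "nat \<Rightarrow> nat \<Rightarrow> (nat \<Rightarrow> real) \<Rightarrow> (nat \<Rightarrow> nat) pmf" where
  "multinomial_pmf p N q = map_pmf (\<lambda>ws j. count_list ws j) (replicate_pmf N (categorical_pmf p q))"

text \<open>The law of \<open>X\<close> when \<open>N X \<sim> Multinomial\<^sub>p(N; q)\<close>.\<close>

definition freq_pmf :: "nat \<Rightarrow> nat \<Rightarrow> (nat \<Rightarrow> real) \<Rightarrow> (nat \<Rightarrow> real) pmf" where
  "freq_pmf p N q = map_pmf (\<lambda>y j. real (y j) / real N) (multinomial_pmf p N q)"

lemma pmf_categorical:
  assumes "q \<in> simplex_vecs p"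
  shows "pmf (categorical_pmf p q) j = (if j < p then q j else 0)"
proof -
  have "(\<integral>\<^sup>+ x. ennreal (if x < p then q x else 0) \<partial>count_space UNIV)
      = (\<Sum>x<p. ennreal (if x < p then q x else 0))"
    by (rule nn_integral_count_space') auto
  also have "\<dots> = ennreal (\<Sum>x<p. q x)"
    using assms by (subst sum_ennreal[symmetric]) (auto simp: simplex_vecs_def)
  also have "\<dots> = 1"
    using assms by (simp add: simplex_vecs_def)
  finally show ?thesis
    unfolding categorical_pmf_def
    using assms by (subst pmf_embed_pmf) (auto simp: simplex_vecs_def)
qed

lemma pmf_replicate:
  "pmf (replicate_pmf N q) xs = (if length xs = N then prod_list (map (pmf q) xs) else 0)"
proof (induction N arbitrary: xs)
  case 0
  then show ?case by (auto simp: pmf_return)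
next
  case (Suc N)
  have eq: "replicate_pmf (Suc N) q = map_pmf (\<lambda>(x, xs). x # xs) (pair_pmf q (replicate_pmf N q))"
    by (simp add: pair_pmf_def map_bind_pmf map_pmf_def bind_assoc_pmf bind_return_pmf)
  show ?case
  proof (cases xs)
    case Nil
    then show ?thesis unfolding eq
      by (auto intro!: pmf_map_outside)
  next
    case (Cons a as)
    have "pmf (replicate_pmf (Suc N) q) ((\<lambda>(x, xs). x # xs) (a, as))
        = pmf (pair_pmf q (replicate_pmf N q)) (a, as)"
      unfolding eq by (rule pmf_map_inj') (auto simp: inj_def)
    then show ?thesis
      using Suc.IH[of as] Cons by (simp add: pmf_pair)
  qed
qed

lemma pmf_multinomial:
  assumes q: "q \<in> simplex_vecs p"
    and y: "\<And>j. p \<le> j \<Longrightarrow> y j = 0" "(\<Sum>j<p. y j) = N"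
  shows "pmf (multinomial_pmf p N q) y = fact N / (\<Prod>j<p. fact (y j)) * (\<Prod>j<p. q j ^ y j)"
proof -
  define M where "M = Abs_multiset y"
  have pos: "{j. 0 < y j} \<subseteq> {..<p}"
  proof
    fix j assume "j \<in> {j. 0 < y j}"
    then show "j \<in> {..<p}" using y(1)[of j] by (cases "j < p") auto
  qed
  then have "finite {j. 0 < y j}"
    by (rule finite_subset) simp
  then have cM: "count M = y"
    by (simp add: M_def)
  have setM: "set_mset M \<subseteq> {..<p}"
    using pos by (simp add: set_mset_def cM)
  have sizeM: "size M = N"
    unfolding size_multiset_overloaded_eq cM y(2)[symmetric]
    by (rule sum.mono_neutral_left) (use setM in \<open>auto simp: set_mset_def cM\<close>)
  have pre: "{ws. (\<lambda>j. count_list ws j) = y} = permutations_of_multiset M"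
    by (simp add: permutations_of_multiset_def multiset_eq_iff cM fun_eq_iff count_mset)
  have word: "pmf (replicate_pmf N (categorical_pmf p q)) ws = (\<Prod>j<p. q j ^ y j)"
    if "ws \<in> permutations_of_multiset M" for ws
  proof -
    have ms: "mset ws = M"
      using that by (simp add: permutations_of_multiset_def)
    have len: "length ws = N"
      using ms sizeM by (metis size_mset)
    have "prod_list (map (pmf (categorical_pmf p q)) ws)
        = prod_mset (image_mset (pmf (categorical_pmf p q)) M)"
      using ms by (metis mset_map prod_mset_prod_list)
    also have "\<dots> = (\<Prod>j\<in>set_mset M. pmf (categorical_pmf p q) j ^ y j)"
      by (simp add: image_prod_mset_multiplicity cM)
    also have "\<dots> = (\<Prod>j<p. pmf (categorical_pmf p q) j ^ y j)"
      by (rule prod.mono_neutral_left) (use setM in \<open>auto simp: set_mset_def cM\<close>)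
    also have "\<dots> = (\<Prod>j<p. q j ^ y j)"
      using q by (simp add: pmf_categorical)
    finally show ?thesis
      using len by (simp add: pmf_replicate)
  qed
  have "pmf (multinomial_pmf p N q) y
      = measure (replicate_pmf N (categorical_pmf p q)) (permutations_of_multiset M)"
    unfolding multinomial_pmf_def pmf_map by (simp add: vimage_def pre)
  also have "\<dots> = (\<Sum>ws\<in>permutations_of_multiset M. \<Prod>j<p. q j ^ y j)"
    by (subst measure_measure_pmf_finite) (auto simp: word)
  also have "\<dots> = real (card (permutations_of_multiset M)) * (\<Prod>j<p. q j ^ y j)"
    by simp
  also have "real (card (permutations_of_multiset M)) = fact N / (\<Prod>j<p. fact (y j))"
  proof -
    have "real (card (permutations_of_multiset M)) = fact N / real (\<Prod>x\<in>set_mset M. fact (y x))"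
      using card_permutations_of_multiset[of M] by (simp add: real_of_nat_div cM sizeM)
    also have "(\<Prod>x\<in>set_mset M. fact (y x)) = (\<Prod>j<p. fact (y j) :: nat)"
      by (rule prod.mono_neutral_left) (use setM in \<open>auto simp: set_mset_def cM\<close>)
    finally show ?thesis by simp
  qed
  finally show ?thesis .
qed

text \<open>The convention is \<open>log 0 = -\<infinity>\<close>: under the library's \<open>ln 0 = 0\<close>, parameters giving probability 0
  to an observed word would look optimal for that word. Every summand has \<open>X j > 0\<close>, so no
  \<open>0 * \<infinity>\<close> arises.\<close>

definition loglik :: "nat \<Rightarrow> nat \<Rightarrow> (nat \<Rightarrow> nat \<Rightarrow> real) \<Rightarrow> (nat \<Rightarrow> real) \<Rightarrow> (nat \<Rightarrow> real) \<Rightarrow> ereal" where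
  "loglik p K A X T = (\<Sum>j | j < p \<and> X j > 0. ereal (X j) *
     (if mat_vec K A T j > 0 then ereal (ln (mat_vec K A T j)) else -\<infinity>))"

definition is_mle :: "nat \<Rightarrow> nat \<Rightarrow> (nat \<Rightarrow> nat \<Rightarrow> real) \<Rightarrow> (nat \<Rightarrow> real) \<Rightarrow> (nat \<Rightarrow> real) \<Rightarrow> bool" where
  "is_mle p K A X = is_arg_max (loglik p K A X) (\<lambda>T. T \<in> simplex_vecs K)"

definition J_upper :: "nat \<Rightarrow> (nat \<Rightarrow> real) \<Rightarrow> nat set" where
  "J_upper p P = {j. j < p \<and> P j > 0}"

definition eps :: "nat \<Rightarrow> nat \<Rightarrow> (nat \<Rightarrow> real) \<Rightarrow> nat \<Rightarrow> real" where
  "eps p N P j = 2 * sqrt (P j * ln (real p) / real N) + 4 * ln (real p) / (3 * real N)"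

definition J_lower :: "nat \<Rightarrow> nat \<Rightarrow> (nat \<Rightarrow> real) \<Rightarrow> nat set" where
  "J_lower p N P = {j. j < p \<and> P j > 2 * eps p N P j}"

definition xi :: "nat \<Rightarrow> nat \<Rightarrow> (nat \<Rightarrow> nat \<Rightarrow> real) \<Rightarrow> (nat \<Rightarrow> real) \<Rightarrow> real" where
  "xi p K A T = Max ((\<lambda>j. norm_inf_on ({..<K} - supp K T) (A j) / norm1_on (supp K T) (A j))
     ` J_upper p (mat_vec K A T))"

definition T_min :: "nat \<Rightarrow> (nat \<Rightarrow> real) \<Rightarrow> real" where
  "T_min K T = Min (T ` supp K T)"

definition cone :: "nat \<Rightarrow> nat set \<Rightarrow> (nat \<Rightarrow> real) set" where
  "cone K S = {v. (\<exists>k<K. v k \<noteq> 0) \<and> norm1_on S v \<ge> norm1_on ({..<K} - S) v}"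

text \<open>\<open>kappa U K A s\<close> is \<open>\<kappa>(A\<^sub>U, s)\<close>. The two nested minima are one infimum: the cone of
  \<open>S = {}\<close> is empty and has no real-valued infimum of its own. For \<open>s, K \<ge> 1\<close> the overall set is
  nonempty and bounded below by 0, and the infimum is attained.\<close>

definition kappa :: "nat set \<Rightarrow> nat \<Rightarrow> (nat \<Rightarrow> nat \<Rightarrow> real) \<Rightarrow> nat \<Rightarrow> real" where
  "kappa U K A s = Inf {norm1_on U (mat_vec K A v) / norm1_on {..<K} v | S v.
     S \<subseteq> {..<K} \<and> card S \<le> s \<and> v \<in> cone K S}"

end

theory Submission
  imports Defs
begin

text \<open>
  Write \<open>S\<close> for the support of \<open>T\<close>, \<open>P = A T\<close>, \<open>D = {j. P j > 0}\<close>, and \<open>\<kappa>\<close> for the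
  restricted \<open>l\<^sub>1\<close> constant. The log-likelihood is concave, so a single candidate \<open>U\<close> supported on \<open>S\<close> certifies the
  claim: if the score \<open>\<Sum>j\<in>D. X j * A j k / (A U) j\<close> is at most 1 for \<open>k \<in> S\<close> and below 1 for
  \<open>k \<notin> S\<close>, then by \<open>ln x \<le> x - 1\<close> a competitor that puts mass outside \<open>S\<close> has a strictly smaller
  likelihood than \<open>U\<close>, so that no maximizer does (\<open>supp_mle_subset\<close>).

  The candidate maximizes the likelihood over the points of the simplex that are supported on \<open>S\<close>
  and lie within \<open>l\<^sub>1\<close>-distance \<open>T_min / 2\<close> of \<open>T\<close>. There \<open>A U\<close> lies between \<open>P / 2\<close> and \<open>3 P / 2\<close>, so that
  all logarithms are finite and the curvature is under control. If \<open>U\<close> turns out to lie strictly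
  inside this ball, then it is optimal on the whole face of the simplex and its scores on \<open>S\<close> are at
  most 1.

  Localization and rate come from the same inequality (\<open>local_mle_deviation\<close>). Put
  \<open>w j = (A U - A T) j / P j\<close>. Optimality in the direction of \<open>T\<close> bounds the empirical quadratic form
  \<open>\<Sum>X w\<^sup>2\<close> by the noise \<open>\<Sum>(X - P) w\<close>. The entries of the empirical Gram matrix of the columns
  \<open>A j k / P j\<close>, \<open>k \<in> S\<close>, deviate by at most
  \<open>\<kappa>\<^sup>2 / 4\<close> with high probability as soon as \<open>N\<close> is at least a large multiple of
  \<open>log (s \<or> n) / (\<kappa>\<^sup>4 T_min\<^sup>3)\<close>, and \<open>\<kappa>\<close> bounds the coefficients by the \<open>L\<^sup>2(P)\<close> norm of \<open>w\<close>; so the empirical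
  and the population forms are equivalent. The noise is tested on an orthonormal basis of the span of
  these columns in \<open>L\<^sup>2(P)\<close> (\<open>finite_test_functions\<close>): there are at most \<open>s\<close> basis elements, each of
  variance at most 1 and of size at most \<open>1 / (\<kappa> T_min)\<close>, so that Bernstein's inequality gives
  the rate \<open>sqrt (s t / N)\<close> for the \<open>L\<^sup>2(P)\<close> norm of \<open>w\<close> at confidence level \<open>t\<close>. Pairing \<open>U - T\<close>
  with the noise in the original coordinates would put \<open>1 / (\<kappa>\<^sup>2 T_min)\<close> in place of \<open>s\<close>.

  For \<open>k \<notin> S\<close> the score at the truth has mean \<open>1 - \<rho> k\<close>, where \<open>\<rho> k\<close> is the mass of column \<open>k\<close> outside
  \<open>D\<close>. Its fluctuation and the error from replacing \<open>P\<close> by \<open>A U\<close> are both governed by the bound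
  \<open>\<xi> / T_min\<close> on \<open>A j k / P j\<close>, and the separation condition makes their sum smaller than \<open>\<rho> k\<close>.
  The basis event is used at level \<open>t = min (log (s \<or> n)) (log K)\<close>: the first bound makes the linear
  Bernstein term harmless through the sample size condition, the second one is what the separation
  condition pays for, and the failure probability is at most
  \<open>2 / (s \<or> n) + 2 / K\<close> whichever of the two is the minimum.
\<close>

section \<open>Bernstein's inequality for multinomial frequencies\<close>

text \<open>
  Keeping \<open>x\<close> bounded on one side only makes the resulting Bernstein inequality need only a one-sided
  bound on the summands. For negative \<open>x\<close> the reason is \<open>(1 + x + x\<^sup>2) (1 - x) = 1 - x\<^sup>3 \<ge> 1\<close>
  together with \<open>1 - x \<le> exp (- x)\<close>.
\<close>

lemma exp_le_quadratic:
  fixes x :: real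
  assumes "x \<le> 1"
  shows "exp x \<le> 1 + x + x\<^sup>2"
proof (cases "0 \<le> x")
  case True
  then show ?thesis using assms by (rule exp_bound)
next
  case False
  have "1 \<le> (1 + x + x\<^sup>2) * (1 - x)"
    using False by (simp add: algebra_simps power2_eq_square mult_nonneg_nonpos mult_nonpos_nonneg)
  also have "\<dots> \<le> (1 + x + x\<^sup>2) * exp (- x)"
    using exp_ge_add_one_self[of "- x"] zero_le_power2[of "x + 1 / 2"]
    by (intro mult_left_mono) (auto simp: power2_eq_square algebra_simps)
  finally show ?thesis
    by (simp add: exp_minus field_simps)
qed

lemma nn_integral_replicate_pmf_exp_sum_list:
  fixes h :: "'a \<Rightarrow> real"
  shows "(\<integral>\<^sup>+ws. ennreal (exp (\<Sum>x\<leftarrow>ws. h x)) \<partial>replicate_pmf N q) = (\<integral>\<^sup>+x. ennreal (exp (h x)) \<partial>q) ^ N"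
proof (induction N)
  case (Suc N)
  have "(\<integral>\<^sup>+ws. ennreal (exp (\<Sum>x\<leftarrow>ws. h x)) \<partial>replicate_pmf (Suc N) q)
      = (\<integral>\<^sup>+x. \<integral>\<^sup>+ws. ennreal (exp (h x)) * ennreal (exp (\<Sum>x\<leftarrow>ws. h x)) \<partial>replicate_pmf N q \<partial>q)"
    by (simp add: exp_add ennreal_mult')
  also have "\<dots> = (\<integral>\<^sup>+x. ennreal (exp (h x)) * (\<integral>\<^sup>+x. ennreal (exp (h x)) \<partial>q) ^ N \<partial>q)"
    by (simp add: nn_integral_cmult Suc.IH)
  also have "\<dots> = (\<integral>\<^sup>+x. ennreal (exp (h x)) \<partial>q) ^ Suc N"
    by (simp add: nn_integral_multc)
  finally show ?case .
qed simp

text \<open>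
  Chernoff's method. The quadratic bound on \<open>exp\<close> gives the logarithmic moment generating function
  \<open>l \<mu> + l\<^sup>2 v\<close> per draw for all \<open>0 \<le> l \<le> 1 / b\<close>. The choice
  \<open>l = sqrt (t / (N v))\<close> if this is admissible, and \<open>l = 1 / b\<close> otherwise, brings the exponent down to \<open>- t\<close>.
\<close>

lemma bernstein_replicate_pmf:
  fixes q :: "'a pmf" and h :: "'a \<Rightarrow> real"
  assumes fin: "finite (set_pmf q)" and N: "0 < N" and b: "0 < b" and v: "0 \<le> v" and t: "0 \<le> t"
    and hb: "\<And>x. x \<in> set_pmf q \<Longrightarrow> h x \<le> b"
    and hv: "measure_pmf.expectation q (\<lambda>x. (h x)\<^sup>2) \<le> v"
  shows "measure_pmf.prob (replicate_pmf N q)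
     {ws. real N * measure_pmf.expectation q h + 2 * sqrt (real N * v * t) + b * t \<le> (\<Sum>x\<leftarrow>ws. h x)}
     \<le> exp (- t)"
proof -
  let ?E = "measure_pmf.expectation q" and ?R = "replicate_pmf N q"
  define \<mu> where "\<mu> = ?E h"
  define u where "u = 2 * sqrt (real N * v * t) + b * t"
  note int = integrable_measure_pmf_finite[OF fin]
  have chernoff: "measure_pmf.prob ?R {ws. real N * \<mu> + u \<le> (\<Sum>x\<leftarrow>ws. h x)} \<le> exp (real N * l\<^sup>2 * v - l * u)"
    if l: "0 \<le> l" "l * b \<le> 1" for l
  proof -
    have lh: "l * h x \<le> 1" if "x \<in> set_pmf q" for x
      using mult_left_mono[OF hb[OF that] l(1)] l(2) by linarith
    have "?E (\<lambda>x. exp (l * h x)) \<le> ?E (\<lambda>x. 1 + l * h x + l\<^sup>2 * (h x)\<^sup>2)"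
      using exp_le_quadratic[OF lh]
      by (intro integral_mono_AE int) (auto simp: AE_measure_pmf_iff power_mult_distrib)
    also have "\<dots> = 1 + l * \<mu> + l\<^sup>2 * ?E (\<lambda>x. (h x)\<^sup>2)"
      by (simp add: int \<mu>_def)
    also have "\<dots> \<le> 1 + (l * \<mu> + l\<^sup>2 * v)"
      using mult_left_mono[OF hv, of "l\<^sup>2"] by simp
    also have "\<dots> \<le> exp (l * \<mu> + l\<^sup>2 * v)"
      by (rule exp_ge_add_one_self)
    finally have mgf: "?E (\<lambda>x. exp (l * h x)) \<le> exp (l * \<mu> + l\<^sup>2 * v)" .
    have "(\<integral>\<^sup>+x. ennreal (exp (l * h x)) \<partial>q) = ennreal (?E (\<lambda>x. exp (l * h x)))"
      by (rule nn_integral_eq_integral) (auto intro: int)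
    also have "\<dots> \<le> ennreal (exp (l * \<mu> + l\<^sup>2 * v))"
      using mgf by (rule ennreal_leI)
    finally have mgf': "(\<integral>\<^sup>+x. ennreal (exp (l * h x)) \<partial>q) \<le> ennreal (exp (l * \<mu> + l\<^sup>2 * v))" .
    have "emeasure ?R {ws. real N * \<mu> + u \<le> (\<Sum>x\<leftarrow>ws. h x)}
        = (\<integral>\<^sup>+ws. indicator {ws. real N * \<mu> + u \<le> (\<Sum>x\<leftarrow>ws. h x)} ws \<partial>?R)"
      by simp
    also have "\<dots> \<le> (\<integral>\<^sup>+ws. ennreal (exp (- l * (real N * \<mu> + u))) * ennreal (exp (\<Sum>x\<leftarrow>ws. l * h x)) \<partial>?R)"
    proof (rule nn_integral_mono)
      fix ws
      have "1 \<le> exp (- l * (real N * \<mu> + u)) * exp (\<Sum>x\<leftarrow>ws. l * h x)"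
        if "real N * \<mu> + u \<le> (\<Sum>x\<leftarrow>ws. h x)"
        using mult_left_mono[OF that l(1)] by (simp add: exp_add[symmetric] sum_list_const_mult)
      then show "indicator {ws. real N * \<mu> + u \<le> (\<Sum>x\<leftarrow>ws. h x)} ws
          \<le> ennreal (exp (- l * (real N * \<mu> + u))) * ennreal (exp (\<Sum>x\<leftarrow>ws. l * h x))"
        by (auto simp: indicator_def ennreal_mult'[symmetric])
    qed
    also have "\<dots> = ennreal (exp (- l * (real N * \<mu> + u))) * (\<integral>\<^sup>+x. ennreal (exp (l * h x)) \<partial>q) ^ N"
      by (simp add: nn_integral_cmult nn_integral_replicate_pmf_exp_sum_list)
    also have "\<dots> \<le> ennreal (exp (- l * (real N * \<mu> + u))) * ennreal (exp (l * \<mu> + l\<^sup>2 * v)) ^ N"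
      by (intro mult_left_mono power_mono mgf') auto
    also have "\<dots> = ennreal (exp (real N * l\<^sup>2 * v - l * u))"
      by (simp add: ennreal_power ennreal_mult'[symmetric] exp_of_nat_mult[symmetric] exp_add[symmetric] algebra_simps)
    finally show ?thesis
      by (simp add: measure_pmf.emeasure_eq_measure)
  qed
  define a where "a = sqrt (real N * v)"
  have a: "0 \<le> a" "a\<^sup>2 = real N * v"
    using v by (auto simp: a_def)
  have u: "u = 2 * a * sqrt t + b * t"
    by (simp add: u_def a_def real_sqrt_mult)
  have "\<exists>l\<ge>0. l * b \<le> 1 \<and> real N * l\<^sup>2 * v - l * u \<le> - t"
  proof (cases "b * sqrt t \<le> a \<and> 0 < a")
    case True
    define l where "l = sqrt t / a"
    have "l\<^sup>2 * a\<^sup>2 = t" "l * a * sqrt t = t"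
      using True t by (simp_all add: l_def power_divide)
    then have "real N * l\<^sup>2 * v - l * u = - t - l * (b * t)"
      using a by (simp add: u algebra_simps)
    moreover have "0 \<le> l" "l * b \<le> 1"
      using True t by (simp_all add: l_def field_simps)
    moreover from this have "0 \<le> l * (b * t)"
      using b t by simp
    ultimately show ?thesis by (intro exI[of _ l]) auto
  next
    case False
    have ab: "a \<le> b * sqrt t"
      using False a(1) b t by (cases "a = 0") auto
    define l where "l = 1 / b"
    have "a * a \<le> a * (b * sqrt t)"
      using ab a(1) by (rule mult_left_mono)
    moreover have "0 \<le> a * (b * sqrt t)"
      using a b t by simp
    ultimately have "a\<^sup>2 \<le> 2 * a * sqrt t * b"
      by (simp add: power2_eq_square algebra_simps)
    then have "a\<^sup>2 * l\<^sup>2 \<le> 2 * a * sqrt t * l"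
      using b by (simp add: l_def power2_eq_square field_simps)
    moreover have "real N * l\<^sup>2 * v - l * u = a\<^sup>2 * l\<^sup>2 - 2 * a * sqrt t * l - t"
      using b a by (simp add: u l_def field_simps)
    ultimately show ?thesis
      using b by (intro exI[of _ l]) (auto simp: l_def)
  qed
  then obtain l where l: "0 \<le> l" "l * b \<le> 1" "real N * l\<^sup>2 * v - l * u \<le> - t"
    by blast
  show ?thesis
    using order_trans[OF chernoff[OF l(1,2)], of "exp (- t)"] l(3)
    by (simp add: u_def \<mu>_def add.assoc)
qed

lemma set_pmf_categorical:
  assumes "q \<in> simplex_vecs p"
  shows "set_pmf (categorical_pmf p q) = J_upper p q"
  using assms by (auto simp: set_pmf_eq pmf_categorical J_upper_def simplex_vecs_def order.strict_iff_order split: if_splits)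

lemma finite_J_upper [simp]: "finite (J_upper p q)"
  by (simp add: J_upper_def)

lemma sum_count_list:
  fixes h :: "'a \<Rightarrow> real"
  assumes "finite D" "set ws \<subseteq> D"
  shows "(\<Sum>j\<in>D. real (count_list ws j) * h j) = (\<Sum>x\<leftarrow>ws. h x)"
  using assms(2)
proof (induction ws)
  case (Cons x ws)
  then have "x \<in> D" by simp
  have "(\<Sum>j\<in>D. real (count_list (x # ws) j) * h j)
      = (\<Sum>j\<in>D. (if j = x then h j else 0) + real (count_list ws j) * h j)"
    by (rule sum.cong) (auto simp: algebra_simps)
  then show ?case
    using Cons \<open>x \<in> D\<close> assms(1) by (simp add: sum.distrib)
qed simp

lemma freq_pmf_replicate:
  "freq_pmf p N q = map_pmf (\<lambda>ws j. real (count_list ws j) / real N) (replicate_pmf N (categorical_pmf p q))"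
  by (simp add: freq_pmf_def multinomial_pmf_def map_pmf_comp)

lemma set_freq_pmf:
  assumes q: "q \<in> simplex_vecs p" and N: "0 < N" and X: "X \<in> set_pmf (freq_pmf p N q)"
  shows "0 \<le> X j" "j \<notin> J_upper p q \<Longrightarrow> X j = 0" "(\<Sum>j\<in>J_upper p q. X j) = 1"
proof -
  obtain ws where ws: "set ws \<subseteq> J_upper p q" "length ws = N" "X = (\<lambda>j. real (count_list ws j) / real N)"
    using X by (auto simp: freq_pmf_replicate set_replicate_pmf set_pmf_categorical[OF q] lists_eq_set)
  show "0 \<le> X j" by (simp add: ws)
  show "X j = 0" if "j \<notin> J_upper p q"
    using that ws(1) by (auto simp: ws(3) count_list_0_iff)
  show "(\<Sum>j\<in>J_upper p q. X j) = 1"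
    using sum_count_list[OF finite_J_upper ws(1), of "\<lambda>_. 1"] N ws(2)
    by (simp add: ws(3) sum_divide_distrib[symmetric] sum_list_triv)
qed

text \<open>
  The frequencies integrate \<open>h\<close> to its average over the \<open>N\<close> draws, so that
  \<open>bernstein_replicate_pmf\<close> applies after division by \<open>N\<close>.
\<close>

lemma bernstein_freq_pmf:
  assumes q: "q \<in> simplex_vecs p" and N: "0 < N" and b: "0 < b" and v: "0 \<le> v" and t: "0 \<le> t"
    and hb: "\<And>j. j \<in> J_upper p q \<Longrightarrow> h j \<le> b"
    and hv: "(\<Sum>j\<in>J_upper p q. q j * (h j)\<^sup>2) \<le> v"
  shows "measure_pmf.prob (freq_pmf p N q)
     {X. 2 * sqrt (v * t / real N) + b * t / real N < (\<Sum>j\<in>J_upper p q. (X j - q j) * h j)} \<le> exp (- t)"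
proof -
  let ?q = "categorical_pmf p q" and ?D = "J_upper p q"
  let ?th = "real N * measure_pmf.expectation ?q h + 2 * sqrt (real N * v * t) + b * t"
  have E: "measure_pmf.expectation ?q f = (\<Sum>j\<in>?D. q j * f j)" for f :: "nat \<Rightarrow> real"
    by (subst integral_measure_pmf_real[of ?D])
       (auto simp: set_pmf_categorical[OF q] pmf_categorical[OF q] J_upper_def intro!: sum.cong)
  have sq: "sqrt (real N * v * t) = real N * sqrt (v * t / real N)"
  proof -
    have "real N * v * t = (real N)\<^sup>2 * (v * t / real N)"
      using N by (simp add: power2_eq_square)
    then show ?thesis
      by (simp only: real_sqrt_mult) simp
  qed
  have "measure_pmf.prob (freq_pmf p N q)
     {X. 2 * sqrt (v * t / real N) + b * t / real N < (\<Sum>j\<in>?D. (X j - q j) * h j)}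
     \<le> measure_pmf.prob (replicate_pmf N ?q) {ws. ?th \<le> (\<Sum>x\<leftarrow>ws. h x)}"
    unfolding freq_pmf_replicate measure_map_pmf
  proof (rule measure_pmf.finite_measure_mono_AE)
    show "AE ws in replicate_pmf N ?q.
       ws \<in> (\<lambda>ws j. real (count_list ws j) / real N) -`
         {X. 2 * sqrt (v * t / real N) + b * t / real N < (\<Sum>j\<in>?D. (X j - q j) * h j)}
        \<longrightarrow> ws \<in> {ws. ?th \<le> (\<Sum>x\<leftarrow>ws. h x)}"
      unfolding AE_measure_pmf_iff
    proof (intro ballI impI)
      fix ws
      assume "ws \<in> set_pmf (replicate_pmf N ?q)"
      then have ws: "set ws \<subseteq> ?D"
        by (auto simp: set_replicate_pmf set_pmf_categorical[OF q])
      assume "ws \<in> (\<lambda>ws j. real (count_list ws j) / real N) -`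
         {X. 2 * sqrt (v * t / real N) + b * t / real N < (\<Sum>j\<in>?D. (X j - q j) * h j)}"
      then have "2 * sqrt (v * t / real N) + b * t / real N
          < (\<Sum>j\<in>?D. real (count_list ws j) * h j) / real N - (\<Sum>j\<in>?D. q j * h j)"
        by (simp add: left_diff_distrib sum_subtractf sum_divide_distrib)
      then have "2 * sqrt (v * t / real N) + b * t / real N + measure_pmf.expectation ?q h < (\<Sum>x\<leftarrow>ws. h x) / real N"
        by (simp add: sum_count_list[OF finite_J_upper ws] E)
      then have "real N * (2 * sqrt (v * t / real N) + b * t / real N + measure_pmf.expectation ?q h) \<le> (\<Sum>x\<leftarrow>ws. h x)"
        using N by (simp add: field_simps)
      then show "ws \<in> {ws. ?th \<le> (\<Sum>x\<leftarrow>ws. h x)}"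
        using N unfolding mem_Collect_eq sq by (simp add: distrib_left)
    qed
  qed simp
  also have "\<dots> \<le> exp (- t)"
    by (rule bernstein_replicate_pmf) (use assms in \<open>auto simp: set_pmf_categorical E\<close>)
  finally show ?thesis .
qed

lemma bernstein_freq_pmf_abs:
  assumes q: "q \<in> simplex_vecs p" and N: "0 < N" and b: "0 < b" and v: "0 \<le> v" and t: "0 \<le> t"
    and hb: "\<And>j. j \<in> J_upper p q \<Longrightarrow> \<bar>h j\<bar> \<le> b"
    and hv: "(\<Sum>j\<in>J_upper p q. q j * (h j)\<^sup>2) \<le> v"
  shows "measure_pmf.prob (freq_pmf p N q)
     {X. 2 * sqrt (v * t / real N) + b * t / real N < \<bar>\<Sum>j\<in>J_upper p q. (X j - q j) * h j\<bar>} \<le> 2 * exp (- t)"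
    (is "measure_pmf.prob _ ?E \<le> _")
proof -
  let ?M = "freq_pmf p N q"
  let ?E1 = "\<lambda>h. {X. 2 * sqrt (v * t / real N) + b * t / real N < (\<Sum>j\<in>J_upper p q. (X j - q j) * h j)}"
  have "?E \<subseteq> ?E1 h \<union> ?E1 (\<lambda>j. - h j)"
    by (auto simp: sum_negf abs_if split: if_splits)
  then have "measure_pmf.prob ?M ?E \<le> measure_pmf.prob ?M (?E1 h \<union> ?E1 (\<lambda>j. - h j))"
    by (rule measure_pmf.finite_measure_mono) simp
  also have "\<dots> \<le> measure_pmf.prob ?M (?E1 h) + measure_pmf.prob ?M (?E1 (\<lambda>j. - h j))"
    by (rule measure_Un_le) auto
  also have "\<dots> \<le> exp (- t) + exp (- t)"
    by (intro add_mono bernstein_freq_pmf) (use assms in \<open>auto simp: abs_le_iff\<close>)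
  finally show ?thesis by simp
qed

lemma prob_UN_le:
  assumes "finite I" "\<And>i. i \<in> I \<Longrightarrow> measure_pmf.prob M (E i) \<le> b"
  shows "measure_pmf.prob M (\<Union>i\<in>I. E i) \<le> real (card I) * b"
proof -
  have "measure_pmf.prob M (\<Union>i\<in>I. E i) \<le> (\<Sum>i\<in>I. measure_pmf.prob M (E i))"
    using assms(1) by (intro measure_pmf.finite_measure_subadditive_finite) auto
  also have "\<dots> \<le> real (card I) * b"
    using sum_bounded_above[of I, OF assms(2)] by simp
  finally show ?thesis .
qed

section \<open>Orthonormal bases of weighted spans\<close>

text \<open>
  Gram-Schmidt in \<open>L\<^sup>2(P)\<close> over the finite set \<open>D\<close>. A column that depends linearly on the previous ones
  leaves residual 0 and adds no basis element; this is where positivity of the weights enters, since a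
  residual of norm 0 must vanish on all of \<open>D\<close>. The coefficients \<open>b\<close> record each basis element as a
  combination of the original columns.
\<close>

lemma orthonormal_family:
  fixes a :: "'k \<Rightarrow> 'j \<Rightarrow> real" and P :: "'j \<Rightarrow> real"
  assumes D: "finite D" "\<And>j. j \<in> D \<Longrightarrow> 0 < P j" and S: "finite S"
  shows "\<exists>(n::nat) e b. n \<le> card S \<and>
    (\<forall>i<n. \<forall>l<n. (\<Sum>j\<in>D. P j * e i j * e l j) = (if i = l then 1 else 0)) \<and>
    (\<forall>i<n. \<forall>j\<in>D. e i j = (\<Sum>k\<in>S. b i k * a k j)) \<and>
    (\<forall>k\<in>S. \<exists>c. \<forall>j\<in>D. a k j = (\<Sum>i<n. c i * e i j))"
  using S
proof (induction S)
  case empty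
  show ?case by (intro exI[of _ 0]) auto
next
  case (insert x F)
  then obtain n e b where n: "n \<le> card F"
    and on: "\<And>i l. i < n \<Longrightarrow> l < n \<Longrightarrow> (\<Sum>j\<in>D. P j * e i j * e l j) = (if i = l then 1 else 0)"
    and eb: "\<And>i j. i < n \<Longrightarrow> j \<in> D \<Longrightarrow> e i j = (\<Sum>k\<in>F. b i k * a k j)"
    and ac: "\<And>k. k \<in> F \<Longrightarrow> \<exists>c. \<forall>j\<in>D. a k j = (\<Sum>i<n. c i * e i j)"
    by blast
  \<comment> \<open>\<open>r\<close> is the part of the new column that is orthogonal to the previous basis.\<close>
  define c where "c i = (\<Sum>j\<in>D. P j * a x j * e i j)" for i
  define r where "r j = a x j - (\<Sum>i<n. c i * e i j)" for j
  define Q where "Q = (\<Sum>j\<in>D. P j * (r j)\<^sup>2)"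
  have Q0: "0 \<le> Q"
    unfolding Q_def using D(2) by (intro sum_nonneg mult_nonneg_nonneg) (auto simp: less_imp_le)
  have orth: "(\<Sum>j\<in>D. P j * r j * e l j) = 0" if "l < n" for l
  proof -
    have "(\<Sum>j\<in>D. P j * r j * e l j) = c l - (\<Sum>j\<in>D. \<Sum>i<n. c i * (P j * e i j * e l j))"
      by (simp add: r_def c_def sum_subtractf[symmetric] algebra_simps sum_distrib_left)
    also have "(\<Sum>j\<in>D. \<Sum>i<n. c i * (P j * e i j * e l j)) = (\<Sum>i<n. c i * (\<Sum>j\<in>D. P j * e i j * e l j))"
      by (subst sum.swap) (simp add: sum_distrib_left)
    also have "\<dots> = (\<Sum>i<n. if i = l then c i else 0)"
      using that by (intro sum.cong) (auto simp: on)
    also have "\<dots> = c l" using that by simp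
    finally show ?thesis by simp
  qed
  have upd: "(\<Sum>k\<in>insert x F. (if k = x then 0 else b i k) * a k j) = (\<Sum>k\<in>F. b i k * a k j)" for i j
    using insert.hyps by simp (rule sum.cong, auto)
  show ?case
  proof (cases "Q = 0")
    case True
    then have "\<forall>j\<in>D. P j * (r j)\<^sup>2 = 0"
      unfolding Q_def using D by (subst sum_nonneg_eq_0_iff[symmetric]) (auto simp: less_imp_le)
    then have "\<forall>j\<in>D. a x j = (\<Sum>i<n. c i * e i j)"
      using D(2) by (fastforce simp: r_def)
    then show ?thesis
      using n on eb ac insert.hyps
      by (intro exI[of _ n] exI[of _ e] exI[of _ "\<lambda>i k. if k = x then 0 else b i k"]) (auto simp: upd)
  next
    case False
    with Q0 have Qp: "0 < Q" by simp
    define e' where "e' i j = (if i < n then e i j else r j / sqrt Q)" for i j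
    define b' where "b' i k = (if i < n then (if k = x then 0 else b i k)
        else (if k = x then 1 else - (\<Sum>i<n. c i * b i k)) / sqrt Q)" for i k
    have old: "e' i = e i" if "i < n" for i using that by (intro ext) (simp add: e'_def)
    have new: "e' n j = r j / sqrt Q" for j by (simp add: e'_def)
    have n_new: "(\<Sum>j\<in>D. P j * e' n j * e' n j) = 1"
    proof -
      have "(\<Sum>j\<in>D. P j * e' n j * e' n j) = Q / (sqrt Q * sqrt Q)"
        by (simp add: new Q_def sum_divide_distrib power2_eq_square mult.assoc)
      then show ?thesis using Qp by simp
    qed
    have o_new: "(\<Sum>j\<in>D. P j * e' n j * e' l j) = 0" "(\<Sum>j\<in>D. P j * e' l j * e' n j) = 0" if "l < n" for l
    proof -
      have "(\<Sum>j\<in>D. P j * e' n j * e' l j) = (\<Sum>j\<in>D. P j * r j * e l j) / sqrt Q"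
        by (simp add: new old[OF that] sum_divide_distrib)
      then show "(\<Sum>j\<in>D. P j * e' n j * e' l j) = 0" using orth[OF that] by simp
      then show "(\<Sum>j\<in>D. P j * e' l j * e' n j) = 0" by (simp add: mult_ac)
    qed
    have 1: "(\<Sum>j\<in>D. P j * e' i j * e' l j) = (if i = l then 1 else 0)" if "i < Suc n" "l < Suc n" for i l
      using that on[of i l] n_new o_new[of i] o_new[of l] old by (auto simp: less_Suc_eq)
    have 2: "e' i j = (\<Sum>k\<in>insert x F. b' i k * a k j)" if "i < Suc n" "j \<in> D" for i j
    proof (cases "i < n")
      case True
      then show ?thesis using eb[OF True that(2)] by (simp only: old b'_def if_True upd)
    next
      case False
      then have i: "i = n" using that by simp
      have "(\<Sum>i<n. c i * e i j) = (\<Sum>i<n. \<Sum>k\<in>F. c i * b i k * a k j)"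
        using eb that(2) by (simp add: sum_distrib_left mult_ac)
      also have "\<dots> = (\<Sum>k\<in>F. (\<Sum>i<n. c i * b i k) * a k j)"
        by (subst sum.swap) (simp add: sum_distrib_right)
      finally have "r j = a x j - (\<Sum>k\<in>F. (\<Sum>i<n. c i * b i k) * a k j)"
        by (simp add: r_def)
      moreover have "(\<Sum>k\<in>insert x F. b' n k * a k j)
          = (a x j - (\<Sum>k\<in>F. (\<Sum>i<n. c i * b i k) * a k j)) / sqrt Q"
      proof -
        have bx: "b' n x = 1 / sqrt Q" by (simp add: b'_def)
        have "(\<Sum>k\<in>F. b' n k * a k j) = (\<Sum>k\<in>F. - ((\<Sum>i<n. c i * b i k) * a k j) / sqrt Q)"
          using insert.hyps by (intro sum.cong) (auto simp: b'_def)
        then show ?thesis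
          using insert.hyps by (simp add: bx sum_divide_distrib[symmetric] sum_negf diff_divide_distrib)
      qed
      ultimately show ?thesis by (simp add: i new)
    qed
    have 3: "\<exists>c. \<forall>j\<in>D. a k j = (\<Sum>i<Suc n. c i * e' i j)" if k: "k \<in> insert x F" for k
    proof (cases "k = x")
      case True
      have "a x j = (\<Sum>i<Suc n. (if i < n then c i else sqrt Q) * e' i j)" for j
        using Qp by (simp add: old new r_def)
      then show ?thesis using True
        by (intro exI[of _ "\<lambda>i. if i < n then c i else sqrt Q"]) blast
    next
      case False
      then obtain d where "\<forall>j\<in>D. a k j = (\<Sum>i<n. d i * e i j)" using ac k by blast
      then have "\<forall>j\<in>D. a k j = (\<Sum>i<Suc n. (if i < n then d i else 0) * e' i j)"
        by (simp add: old)
      then show ?thesis by (intro exI[of _ "\<lambda>i. if i < n then d i else 0"])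
    qed
    have "Suc n \<le> card (insert x F)" using n insert.hyps by simp
    then show ?thesis using 1 2 3 by blast
  qed
qed

text \<open>
  A linear functional that is at most \<open>\<tau>\<close> on every element of an orthonormal basis has norm at most
  \<open>sqrt (card S) * \<tau>\<close> on the span, by Cauchy-Schwarz for the coordinates. So the supremum of the noise
  over all coefficient vectors \<open>v\<close> is controlled by \<open>card S\<close> deterministic test functions.
\<close>

lemma finite_test_functions:
  fixes a :: "'k \<Rightarrow> 'j \<Rightarrow> real" and P :: "'j \<Rightarrow> real"
  assumes D: "finite D" "\<And>j. j \<in> D \<Longrightarrow> 0 < P j" and S: "finite S"
  obtains n :: nat and e b where "n \<le> card S"
    and "\<And>i. i < n \<Longrightarrow> (\<Sum>j\<in>D. P j * (e i j)\<^sup>2) = 1"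
    and "\<And>i j. i < n \<Longrightarrow> j \<in> D \<Longrightarrow> e i j = (\<Sum>k\<in>S. b i k * a k j)"
    and "\<And>z v \<tau>. (\<And>i. i < n \<Longrightarrow> \<bar>\<Sum>j\<in>D. z j * e i j\<bar> \<le> \<tau>) \<Longrightarrow> 0 \<le> \<tau> \<Longrightarrow>
      (\<Sum>j\<in>D. z j * (\<Sum>k\<in>S. v k * a k j))
        \<le> sqrt (\<Sum>j\<in>D. P j * (\<Sum>k\<in>S. v k * a k j)\<^sup>2) * (sqrt (real (card S)) * \<tau>)"
proof -
  have "\<exists>(n::nat) e b. n \<le> card S \<and>
    (\<forall>i<n. \<forall>l<n. (\<Sum>j\<in>D. P j * e i j * e l j) = (if i = l then 1 else 0)) \<and>
    (\<forall>i<n. \<forall>j\<in>D. e i j = (\<Sum>k\<in>S. b i k * a k j)) \<and>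
    (\<forall>k\<in>S. \<exists>c. \<forall>j\<in>D. a k j = (\<Sum>i<n. c i * e i j))"
    by (rule orthonormal_family) (use D S in auto)
  then obtain n :: nat and e b where *: "n \<le> card S \<and>
    (\<forall>i<n. \<forall>l<n. (\<Sum>j\<in>D. P j * e i j * e l j) = (if i = l then 1 else 0)) \<and>
    (\<forall>i<n. \<forall>j\<in>D. e i j = (\<Sum>k\<in>S. b i k * a k j)) \<and>
    (\<forall>k\<in>S. \<exists>c. \<forall>j\<in>D. a k j = (\<Sum>i<n. c i * e i j))"
    by (elim exE) (erule that)
  have n: "n \<le> card S"
    and on: "\<And>i l. i < n \<Longrightarrow> l < n \<Longrightarrow> (\<Sum>j\<in>D. P j * e i j * e l j) = (if i = l then 1 else 0)"
    and eb: "\<And>i j. i < n \<Longrightarrow> j \<in> D \<Longrightarrow> e i j = (\<Sum>k\<in>S. b i k * a k j)"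
    and ac: "\<forall>k\<in>S. \<exists>c. \<forall>j\<in>D. a k j = (\<Sum>i<n. c i * e i j)"
    using * by blast+
  from bchoice[OF ac] obtain c where c: "\<And>k j. k \<in> S \<Longrightarrow> j \<in> D \<Longrightarrow> a k j = (\<Sum>i<n. c k i * e i j)"
    by blast
  have "(\<Sum>j\<in>D. z j * (\<Sum>k\<in>S. v k * a k j))
        \<le> sqrt (\<Sum>j\<in>D. P j * (\<Sum>k\<in>S. v k * a k j)\<^sup>2) * (sqrt (real (card S)) * \<tau>)"
    if z: "\<And>i. i < n \<Longrightarrow> \<bar>\<Sum>j\<in>D. z j * e i j\<bar> \<le> \<tau>" and \<tau>: "0 \<le> \<tau>" for z v \<tau>
  proof -
    define d where "d i = (\<Sum>k\<in>S. v k * c k i)" for i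
    define Z where "Z i = (\<Sum>j\<in>D. z j * e i j)" for i
    have w: "(\<Sum>k\<in>S. v k * a k j) = (\<Sum>i<n. d i * e i j)" if "j \<in> D" for j
    proof -
      have "(\<Sum>k\<in>S. v k * a k j) = (\<Sum>k\<in>S. \<Sum>i<n. v k * c k i * e i j)"
        using that by (simp add: c sum_distrib_left mult_ac)
      also have "\<dots> = (\<Sum>i<n. d i * e i j)"
        by (subst sum.swap) (simp add: d_def sum_distrib_right)
      finally show ?thesis .
    qed
    have "(\<Sum>j\<in>D. P j * (\<Sum>k\<in>S. v k * a k j)\<^sup>2)
        = (\<Sum>j\<in>D. \<Sum>i<n. \<Sum>l<n. d i * d l * (P j * e i j * e l j))"
      by (intro sum.cong refl) (simp add: w power2_eq_square sum_product sum_distrib_left mult_ac)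
    also have "\<dots> = (\<Sum>i<n. \<Sum>l<n. d i * d l * (\<Sum>j\<in>D. P j * e i j * e l j))"
      by (subst sum.swap, intro sum.cong refl, subst sum.swap) (simp add: sum_distrib_left)
    also have "\<dots> = (\<Sum>i<n. \<Sum>l<n. if l = i then d i * d l else 0)"
      by (intro sum.cong refl) (auto simp: on)
    also have "\<dots> = (\<Sum>i<n. (d i)\<^sup>2)"
      by (simp add: power2_eq_square)
    finally have norm: "(\<Sum>j\<in>D. P j * (\<Sum>k\<in>S. v k * a k j)\<^sup>2) = (\<Sum>i<n. (d i)\<^sup>2)" .
    have "(\<Sum>j\<in>D. z j * (\<Sum>k\<in>S. v k * a k j)) = (\<Sum>j\<in>D. \<Sum>i<n. d i * (z j * e i j))"
      by (intro sum.cong refl) (simp add: w sum_distrib_left mult_ac)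
    also have "\<dots> = (\<Sum>i<n. d i * Z i)"
      by (subst sum.swap) (simp add: Z_def sum_distrib_left)
    also have "\<dots> \<le> L2_set d {..<n} * L2_set Z {..<n}"
      by (rule order_trans[OF _ L2_set_mult_ineq]) (intro sum_mono, metis abs_ge_self abs_mult)
    also have "\<dots> \<le> L2_set d {..<n} * (sqrt (real (card S)) * \<tau>)"
    proof (rule mult_left_mono)
      have "(\<Sum>i<n. (Z i)\<^sup>2) \<le> (\<Sum>i<n. \<tau>\<^sup>2)"
        using z \<tau> by (intro sum_mono) (auto simp: Z_def intro: abs_le_square_iff[THEN iffD1])
      also have "\<dots> \<le> real (card S) * \<tau>\<^sup>2"
        using n by (simp add: mult_right_mono)
      finally have "sqrt (\<Sum>i<n. (Z i)\<^sup>2) \<le> sqrt (real (card S) * \<tau>\<^sup>2)"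
        by (rule real_sqrt_le_mono)
      then show "L2_set Z {..<n} \<le> sqrt (real (card S)) * \<tau>"
        using \<tau> by (simp add: L2_set_def real_sqrt_mult)
    qed simp
    finally show ?thesis by (simp add: norm L2_set_def)
  qed
  moreover have "(\<Sum>j\<in>D. P j * (e i j)\<^sup>2) = 1" if "i < n" for i
    using on[OF that that] by (simp add: power2_eq_square mult.assoc)
  ultimately show ?thesis using that n eb by blast
qed

section \<open>Geometry of the topic model\<close>

lemma supp_subset: "supp K T \<subseteq> {..<K}" by (auto simp: supp_def)

lemma finite_supp [simp]: "finite (supp K T)" by (simp add: supp_def)

text \<open>
  The names \<open>P\<close>, \<open>S\<close>, \<open>D\<close>, \<open>Tm\<close> stand for \<open>\<Pi>\<^sub>*\<close>, \<open>S\<^sub>*\<close>, the support of \<open>\<Pi>\<^sub>*\<close>, and \<open>T\<^sub>m\<^sub>i\<^sub>n\<close>.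
\<close>

locale topic_model =
  fixes p K :: nat and A :: "nat \<Rightarrow> nat \<Rightarrow> real" and T :: "nat \<Rightarrow> real"
  assumes A_simplex: "\<And>k. k < K \<Longrightarrow> (\<lambda>j. A j k) \<in> simplex_vecs p"
    and T_simplex: "T \<in> simplex_vecs K"
begin

abbreviation "P \<equiv> mat_vec K A T"
abbreviation "S \<equiv> supp K T"
abbreviation "D \<equiv> J_upper p P"
abbreviation "Tm \<equiv> T_min K T"

lemma A_nonneg: "j < p \<Longrightarrow> k < K \<Longrightarrow> 0 \<le> A j k"
  using A_simplex by (auto simp: simplex_vecs_def)

lemma A_col_sum: "k < K \<Longrightarrow> (\<Sum>j<p. A j k) = 1"
  using A_simplex by (auto simp: simplex_vecs_def)

lemma S_less: "k \<in> S \<Longrightarrow> k < K" by (simp add: supp_def)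

lemma D_less: "j \<in> D \<Longrightarrow> j < p" by (simp add: J_upper_def)

lemma P_pos: "j \<in> D \<Longrightarrow> 0 < P j" by (simp add: J_upper_def)

lemma T_pos: "k \<in> S \<Longrightarrow> 0 < T k"
  using T_simplex by (auto simp: simplex_vecs_def supp_def order.strict_iff_order)

lemma mat_vec_restrict:
  assumes "\<And>k. k \<notin> S \<Longrightarrow> k < K \<Longrightarrow> v k = 0"
  shows "mat_vec K A v j = (\<Sum>k\<in>S. v k * A j k)"
  unfolding mat_vec_def
  by (rule sum.mono_neutral_cong_right) (use assms supp_subset in \<open>auto simp: mult.commute\<close>)

lemma P_eq: "P j = (\<Sum>k\<in>S. T k * A j k)"
  by (rule mat_vec_restrict) (auto simp: supp_def)

lemma sum_T: "(\<Sum>k\<in>S. T k) = 1"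
proof -
  have "(\<Sum>k\<in>S. T k) = (\<Sum>k<K. T k)"
    by (rule sum.mono_neutral_left) (auto simp: supp_def)
  then show ?thesis using T_simplex by (simp add: simplex_vecs_def)
qed

lemma P_nonneg: "j < p \<Longrightarrow> 0 \<le> P j"
  unfolding P_eq using T_pos A_nonneg S_less by (intro sum_nonneg) (auto simp: less_imp_le)

lemma sum_mat_vec: "(\<Sum>j<p. mat_vec K A v j) = (\<Sum>k<K. v k)"
  unfolding mat_vec_def
  by (subst sum.swap) (simp add: sum_distrib_right[symmetric] A_col_sum)

lemma P_simplex: "P \<in> simplex_vecs p"
  using P_nonneg T_simplex by (simp add: simplex_vecs_def sum_mat_vec)

text \<open>
  A word of probability 0 under the mixture has probability 0 under every topic that is present.
\<close>

lemma A_zero: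
  assumes "j < p" "j \<notin> D" "k \<in> S"
  shows "A j k = 0"
proof -
  have "P j = 0" using assms P_nonneg[of j] by (auto simp: J_upper_def)
  moreover have "T k * A j k \<le> P j"
    unfolding P_eq by (rule member_le_sum) (use assms T_pos A_nonneg S_less in \<open>auto simp: less_imp_le\<close>)
  ultimately show ?thesis
    using A_nonneg[of j k] T_pos[OF assms(3)] S_less[OF assms(3)] assms(1)
    by (auto simp: mult_le_0_iff)
qed

lemma sum_D_A: "k \<in> S \<Longrightarrow> (\<Sum>j\<in>D. A j k) = 1"
proof -
  assume k: "k \<in> S"
  have "(\<Sum>j\<in>D. A j k) = (\<Sum>j<p. A j k)"
    by (rule sum.mono_neutral_left) (use k A_zero D_less in auto)
  then show ?thesis using A_col_sum S_less[OF k] by simp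
qed

lemma sum_D_S: "(\<Sum>j\<in>D. \<Sum>k\<in>S. v k * A j k) = (\<Sum>k\<in>S. v k)"
  by (subst sum.swap) (simp add: sum_distrib_left[symmetric] sum_D_A)

lemma sum_P: "(\<Sum>j\<in>D. P j) = 1"
  unfolding P_eq sum_D_S sum_T ..

lemma S_nonempty: "S \<noteq> {}"
  using sum_T by auto

lemma D_nonempty: "D \<noteq> {}"
  using sum_P by auto

lemma Tm_le: "k \<in> S \<Longrightarrow> Tm \<le> T k"
  unfolding T_min_def by (rule Min_le) auto

lemma Tm_pos: "0 < Tm"
  unfolding T_min_def using S_nonempty T_pos by (subst Min_gr_iff) auto

lemma card_S_Tm: "real (card S) * Tm \<le> 1"
  using sum_mono[of S "\<lambda>_. Tm" T] Tm_le sum_T by simp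

lemma Tm_le_1: "Tm \<le> 1"
proof -
  have "1 \<le> card S" using S_nonempty by (simp add: Suc_le_eq card_gt_0_iff)
  then have "1 * Tm \<le> real (card S) * Tm" using Tm_pos by (intro mult_right_mono) auto
  then show ?thesis using card_S_Tm by simp
qed

lemma ratio_nonneg: "j \<in> D \<Longrightarrow> k < K \<Longrightarrow> 0 \<le> A j k / P j"
  using A_nonneg P_pos D_less by (simp add: less_imp_le)

lemma Tm_norm1_le_P:
  assumes "j \<in> D"
  shows "Tm * norm1_on S (A j) \<le> P j"
  unfolding norm1_on_def P_eq sum_distrib_left
  using assms Tm_le A_nonneg S_less D_less by (intro sum_mono mult_mono) (auto simp: T_pos less_imp_le)

lemma ratio_le_on_support:
  assumes "j \<in> D" "k \<in> S"
  shows "A j k / P j \<le> 1 / Tm"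
proof -
  have "\<bar>A j k\<bar> \<le> norm1_on S (A j)"
    unfolding norm1_on_def by (rule member_le_sum) (use assms in auto)
  then have "Tm * A j k \<le> Tm * norm1_on S (A j)"
    using Tm_pos by (intro mult_left_mono) auto
  also note Tm_norm1_le_P[OF assms(1)]
  finally show ?thesis
    using P_pos[OF assms(1)] Tm_pos by (simp add: field_simps)
qed

text \<open>
  Coefficients of size \<open>r\<close> on \<open>S\<close> are dominated by \<open>(r / Tm) * T\<close>, whose image under \<open>A\<close> is \<open>(r / Tm) * P\<close>.
  This converts smallness of a coefficient vector into smallness relative to \<open>P\<close>, row by row.
\<close>

lemma combination_le_P:
  assumes "j \<in> D" "\<And>k. k \<in> S \<Longrightarrow> \<bar>v k\<bar> \<le> r"
  shows "\<bar>\<Sum>k\<in>S. v k * A j k\<bar> \<le> r / Tm * P j"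
proof -
  have r: "0 \<le> r" using S_nonempty assms(2) by fastforce
  have "\<bar>\<Sum>k\<in>S. v k * A j k\<bar> \<le> (\<Sum>k\<in>S. r * \<bar>A j k\<bar>)"
    using assms(2) by (intro order_trans[OF sum_abs] sum_mono) (auto simp: abs_mult intro: mult_right_mono)
  also have "\<dots> = r / Tm * (Tm * norm1_on S (A j))"
    using Tm_pos by (simp add: norm1_on_def sum_distrib_left)
  also have "\<dots> \<le> r / Tm * P j"
    using r Tm_pos Tm_norm1_le_P[OF assms(1)] by (intro mult_left_mono) auto
  finally show ?thesis .
qed

lemma xi_nonneg: "S \<noteq> {..<K} \<Longrightarrow> 0 \<le> xi p K A T"
  and ratio_le_off_support: "j \<in> D \<Longrightarrow> k < K \<Longrightarrow> k \<notin> S \<Longrightarrow> A j k / P j \<le> xi p K A T / Tm"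
proof -
  let ?f = "\<lambda>j. norm_inf_on ({..<K} - S) (A j) / norm1_on S (A j)"
  have xi: "?f j \<le> xi p K A T" if "j \<in> D" for j
    unfolding xi_def using that by (intro Max_ge finite_imageI imageI) auto
  have ninf: "\<bar>A j k\<bar> \<le> norm_inf_on ({..<K} - S) (A j)" if "k < K" "k \<notin> S" for j k
    unfolding norm_inf_on_def by (rule Max_ge) (use that in auto)
  have n1: "0 \<le> norm1_on S (A j)" for j by (simp add: norm1_on_def sum_nonneg)
  show "0 \<le> xi p K A T" if ne: "S \<noteq> {..<K}"
  proof -
    obtain k where k: "k < K" "k \<notin> S" using ne supp_subset[of K T] by auto
    obtain j where "j \<in> D" using D_nonempty by auto
    moreover have "0 \<le> ?f j" using ninf[OF k, of j] n1[of j] by (simp add: divide_nonneg_nonneg)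
    ultimately show ?thesis using xi by fastforce
  qed
  show "A j k / P j \<le> xi p K A T / Tm" if j: "j \<in> D" and k: "k < K" "k \<notin> S"
  proof -
    have "norm1_on S (A j) \<noteq> 0"
    proof
      assume "norm1_on S (A j) = 0"
      then have "\<forall>k\<in>S. A j k = 0" by (simp add: norm1_on_def sum_nonneg_eq_0_iff)
      then have "P j = 0" by (simp add: P_eq)
      then show False using P_pos[OF j] by simp
    qed
    then have n1': "0 < norm1_on S (A j)" using n1[of j] by simp
    have "A j k \<le> ?f j * norm1_on S (A j)"
      using ninf[OF k, of j] n1' by simp
    also have "\<dots> \<le> xi p K A T * (P j / Tm)"
    proof (rule mult_mono)
      show "norm1_on S (A j) \<le> P j / Tm"
        using Tm_norm1_le_P[OF j] Tm_pos by (simp add: field_simps)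
      show "0 \<le> xi p K A T"
        using xi[OF j] ninf[OF k, of j] n1' by (meson abs_ge_zero divide_nonneg_pos order_trans)
    qed (use xi[OF j] n1 in auto)
    finally show ?thesis using P_pos[OF j] Tm_pos by (simp add: field_simps)
  qed
qed

text \<open>
  Extended by 0, a vector supported on \<open>S\<close> lies in the cone of \<open>S\<close> trivially. Enlarging the row set
  from \<open>U\<close> to \<open>D\<close> only increases the norm of its image.
\<close>

lemma kappa_norm1_le:
  assumes U: "U \<subseteq> D" and s: "card S \<le> s"
  shows "kappa U K A s * (\<Sum>k\<in>S. \<bar>v k\<bar>) \<le> (\<Sum>j\<in>D. \<bar>\<Sum>k\<in>S. v k * A j k\<bar>)"
proof (cases "(\<Sum>k\<in>S. \<bar>v k\<bar>) = 0")
  case False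
  define u where "u k = (if k \<in> S then v k else 0)" for k
  have finU: "finite U" using U by (rule finite_subset) simp
  have S: "S \<subseteq> {..<K}" by (rule supp_subset)
  have u1: "norm1_on {..<K} u = (\<Sum>k\<in>S. \<bar>v k\<bar>)"
    unfolding norm1_on_def by (rule sum.mono_neutral_cong_right) (use S in \<open>auto simp: u_def\<close>)
  have pos: "0 < (\<Sum>k\<in>S. \<bar>v k\<bar>)"
    using False by (simp add: order.strict_iff_order sum_nonneg)
  have "u \<in> cone K S"
  proof -
    have "\<exists>k\<in>S. v k \<noteq> 0" using False by (auto intro: ccontr)
    moreover have "norm1_on ({..<K} - S) u = 0" by (simp add: norm1_on_def u_def)
    ultimately show ?thesis
      unfolding cone_def using S_less by (auto simp: u_def norm1_on_def sum_nonneg)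
  qed
  then have "kappa U K A s \<le> norm1_on U (mat_vec K A u) / norm1_on {..<K} u"
    unfolding kappa_def
    by (intro cInf_lower bdd_belowI[of _ 0]) (use S s in \<open>auto simp: norm1_on_def sum_nonneg\<close>)
  then have "kappa U K A s * (\<Sum>k\<in>S. \<bar>v k\<bar>) \<le> norm1_on U (mat_vec K A u)"
    using pos by (simp add: u1 field_simps)
  also have "\<dots> \<le> norm1_on D (mat_vec K A u)"
    unfolding norm1_on_def using U by (intro sum_mono2) auto
  also have "\<dots> = (\<Sum>j\<in>D. \<bar>\<Sum>k\<in>S. v k * A j k\<bar>)"
    unfolding norm1_on_def by (subst mat_vec_restrict) (auto simp: u_def intro!: sum.cong)
  finally show ?thesis .
qed (simp add: sum_nonneg)

lemma kappa_le_1: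
  assumes "U \<subseteq> D" "card S \<le> s"
  shows "kappa U K A s \<le> 1"
proof -
  have "(\<Sum>k\<in>S. \<bar>T k\<bar>) = (\<Sum>k\<in>S. T k)"
    using T_pos by (intro sum.cong) (auto simp: abs_of_pos)
  moreover have "(\<Sum>j\<in>D. \<bar>P j\<bar>) = (\<Sum>j\<in>D. P j)"
    by (intro sum.cong) (auto dest: P_pos)
  ultimately show ?thesis
    using kappa_norm1_le[OF assms, of T] sum_P sum_T by (simp add: P_eq[symmetric])
qed

lemma J_lower_subset: "1 \<le> p \<Longrightarrow> J_lower p N P \<subseteq> D"
proof
  fix j assume p: "1 \<le> p" and j: "j \<in> J_lower p N P"
  have "0 \<le> ln (real p)" using p by simp
  then have "0 \<le> eps p N P j"
    using P_nonneg[of j] j by (auto simp: eps_def J_lower_def)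
  then show "j \<in> D" using j by (auto simp: J_lower_def J_upper_def)
qed

text \<open>
  Since \<open>P\<close> is a probability vector on \<open>D\<close>, the \<open>L\<^sup>1(P)\<close> norm of the relative perturbation
  \<open>(A v) j / P j\<close>, which is the \<open>l\<^sub>1\<close> norm of \<open>A v\<close>, is at most its \<open>L\<^sup>2(P)\<close> norm.
\<close>

lemma kappa_norm1_le_L2:
  assumes "U \<subseteq> D" "card S \<le> s"
  shows "kappa U K A s * (\<Sum>k\<in>S. \<bar>v k\<bar>) \<le> sqrt (\<Sum>j\<in>D. P j * (\<Sum>k\<in>S. v k * (A j k / P j))\<^sup>2)"
proof -
  define w where "w j = (\<Sum>k\<in>S. v k * (A j k / P j))" for j
  have "kappa U K A s * (\<Sum>k\<in>S. \<bar>v k\<bar>) \<le> (\<Sum>j\<in>D. \<bar>\<Sum>k\<in>S. v k * A j k\<bar>)"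
    by (rule kappa_norm1_le[OF assms])
  also have "\<dots> = (\<Sum>j\<in>D. sqrt (P j) * (sqrt (P j) * \<bar>w j\<bar>))"
  proof (rule sum.cong)
    fix j assume j: "j \<in> D"
    have "(\<Sum>k\<in>S. v k * A j k) = P j * w j"
      using P_pos[OF j] by (simp add: w_def sum_distrib_left)
    then show "\<bar>\<Sum>k\<in>S. v k * A j k\<bar> = sqrt (P j) * (sqrt (P j) * \<bar>w j\<bar>)"
      using P_pos[OF j] by (simp add: abs_mult mult.assoc[symmetric])
  qed simp
  also have "\<dots> \<le> L2_set (\<lambda>j. sqrt (P j)) D * L2_set (\<lambda>j. sqrt (P j) * \<bar>w j\<bar>) D"
    by (rule order_trans[OF _ L2_set_mult_ineq]) (intro sum_mono, metis abs_ge_self abs_mult)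
  also have "L2_set (\<lambda>j. sqrt (P j)) D = sqrt (\<Sum>j\<in>D. P j)"
    unfolding L2_set_def using P_pos by (intro arg_cong[of _ _ sqrt] sum.cong) (auto simp: less_imp_le)
  also have "\<dots> = 1" by (simp add: sum_P)
  also have "L2_set (\<lambda>j. sqrt (P j) * \<bar>w j\<bar>) D = sqrt (\<Sum>j\<in>D. P j * (w j)\<^sup>2)"
    unfolding L2_set_def using P_pos
    by (intro arg_cong[of _ _ sqrt] sum.cong) (auto simp: less_imp_le power_mult_distrib)
  finally show ?thesis by (simp add: w_def)
qed

section \<open>The maximizer near the truth and its optimality conditions\<close>

text \<open>
  The part of the face spanned by \<open>S\<close> that is close to \<open>T\<close>. The radius \<open>Tm / 2\<close> keeps the
  coordinates in \<open>S\<close> positive. Elements are required to vanish at all indices outside \<open>S\<close>, also those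
  beyond \<open>K\<close>, so that the set is compact in the product topology.
\<close>

definition nbhd :: "(nat \<Rightarrow> real) set" where
  "nbhd = {U. (\<forall>k. k \<notin> S \<longrightarrow> U k = 0) \<and> (\<Sum>k\<in>S. U k) = 1 \<and> (\<Sum>k\<in>S. \<bar>U k - T k\<bar>) \<le> Tm / 2}"

lemma mat_vec_nbhd: "U \<in> nbhd \<Longrightarrow> mat_vec K A U j = (\<Sum>k\<in>S. U k * A j k)"
  by (rule mat_vec_restrict) (auto simp: nbhd_def)

lemma nbhd_component:
  assumes "U \<in> nbhd" "k \<in> S"
  shows "\<bar>U k - T k\<bar> \<le> Tm / 2" "0 < U k"
proof -
  have "\<bar>U k - T k\<bar> \<le> (\<Sum>k\<in>S. \<bar>U k - T k\<bar>)"
    by (rule member_le_sum) (use assms in auto)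
  then show 1: "\<bar>U k - T k\<bar> \<le> Tm / 2" using assms(1) by (simp add: nbhd_def)
  show "0 < U k" using 1 Tm_le[OF assms(2)] Tm_pos by linarith
qed

lemma nbhd_mat_vec:
  assumes "U \<in> nbhd" "j \<in> D"
  shows "\<bar>mat_vec K A U j - P j\<bar> \<le> P j / 2" "0 < mat_vec K A U j"
proof -
  have "mat_vec K A U j - P j = (\<Sum>k\<in>S. (U k - T k) * A j k)"
    by (simp add: mat_vec_nbhd[OF assms(1)] P_eq left_diff_distrib sum_subtractf)
  then show 1: "\<bar>mat_vec K A U j - P j\<bar> \<le> P j / 2"
    using combination_le_P[OF assms(2), of "\<lambda>k. U k - T k" "Tm / 2"] nbhd_component(1)[OF assms(1)] Tm_pos
    by simp
  show "0 < mat_vec K A U j" using 1 P_pos[OF assms(2)] by linarith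
qed

text \<open>
  Only the values of \<open>T\<close> below \<open>K\<close> are meaningful; setting the others to 0 makes it an element of \<open>nbhd\<close>.
\<close>

definition truth :: "nat \<Rightarrow> real" where "truth k = (if k \<in> S then T k else 0)"

lemma truth_nbhd: "truth \<in> nbhd"
  using sum_T Tm_pos by (simp add: nbhd_def truth_def cong: sum.cong)

lemma mat_vec_truth: "mat_vec K A truth = P"
  by (rule ext) (simp add: mat_vec_nbhd[OF truth_nbhd] P_eq truth_def)

text \<open>
  By Tychonoff's theorem the surrounding box is compact in the product topology, and the constraints
  are closed because each of them involves only finitely many coordinates or a single one.
\<close>

lemma compact_nbhd: "compact nbhd"
proof -
  define B where "B = PiE UNIV (\<lambda>k::nat. {- (\<bar>T k\<bar> + Tm) .. \<bar>T k\<bar> + Tm})"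
  have "compactin (product_topology (\<lambda>_. euclidean) UNIV) B"
    unfolding B_def by (subst compactin_PiE) auto
  then have "compact B" by (simp add: euclidean_product_topology)
  moreover have "closed nbhd"
  proof -
    have eq: "nbhd = (\<Inter>k\<in>- S. {U. U k = 0}) \<inter> {U. (\<Sum>k\<in>S. U k) = 1} \<inter> {U. (\<Sum>k\<in>S. \<bar>U k - T k\<bar>) \<le> Tm / 2}"
      by (auto simp: nbhd_def)
    show "closed nbhd"
      unfolding eq
      by (intro closed_Int closed_INT ballI closed_Collect_eq closed_Collect_le
          continuous_intros continuous_on_product_coordinates)
  qed
  moreover have "nbhd \<subseteq> B"
  proof
    fix U assume U: "U \<in> nbhd"
    have "U k \<in> {- (\<bar>T k\<bar> + Tm) .. \<bar>T k\<bar> + Tm}" for k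
    proof (cases "k \<in> S")
      case True
      have "\<bar>U k\<bar> \<le> \<bar>U k - T k\<bar> + \<bar>T k\<bar>" by linarith
      then have "\<bar>U k\<bar> \<le> \<bar>T k\<bar> + Tm" using nbhd_component(1)[OF U True] Tm_pos by linarith
      then show ?thesis by (auto simp: abs_le_iff)
    next
      case False
      then show ?thesis using U Tm_pos by (simp add: nbhd_def)
    qed
    then show "U \<in> B" by (auto simp: B_def)
  qed
  ultimately show ?thesis using compact_Int_closed[of B nbhd] by (simp add: inf.absorb2)
qed

definition local_mle :: "(nat \<Rightarrow> real) \<Rightarrow> (nat \<Rightarrow> real) \<Rightarrow> bool" where
  "local_mle X U \<longleftrightarrow> U \<in> nbhd \<and>
    (\<forall>V\<in>nbhd. (\<Sum>j\<in>D. X j * ln (mat_vec K A V j)) \<le> (\<Sum>j\<in>D. X j * ln (mat_vec K A U j)))"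

lemma local_mle_exists: "\<exists>U. local_mle X U"
proof -
  have "continuous_on nbhd (\<lambda>U. U k)" for k
    by (rule continuous_on_subset[OF continuous_on_product_coordinates]) simp
  then have "continuous_on nbhd (\<lambda>U. mat_vec K A U j)" for j
    unfolding mat_vec_def by (intro continuous_intros)
  then have "continuous_on nbhd (\<lambda>U. \<Sum>j\<in>D. X j * ln (mat_vec K A U j))"
    by (intro continuous_on_sum continuous_on_mult continuous_on_const continuous_on_ln)
       (auto dest: nbhd_mat_vec(2))
  then show ?thesis
    using continuous_attains_sup[OF compact_nbhd] truth_nbhd unfolding local_mle_def by blast
qed

lemma mat_vec_segment:
  "mat_vec K A (\<lambda>k. U k + h * (V k - U k)) j = mat_vec K A U j + h * (mat_vec K A V j - mat_vec K A U j)"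
  by (simp add: mat_vec_def sum_distrib_left sum.distrib[symmetric] sum_subtractf[symmetric] algebra_simps)

text \<open>
  A positive derivative along a feasible segment would increase the likelihood at once.
\<close>

lemma local_mle_first_order:
  assumes mle: "local_mle X U"
    and seg: "0 < d" "\<And>h. 0 < h \<Longrightarrow> h \<le> d \<Longrightarrow> (\<lambda>k. U k + h * (V k - U k)) \<in> nbhd"
  shows "(\<Sum>j\<in>D. X j * ((mat_vec K A V j - mat_vec K A U j) / mat_vec K A U j)) \<le> 0"
proof (rule ccontr)
  assume *: "\<not> ?thesis"
  have U: "U \<in> nbhd" using mle by (simp add: local_mle_def)
  let ?u = "mat_vec K A U" and ?v = "mat_vec K A V"
  let ?\<phi> = "\<lambda>h. \<Sum>j\<in>D. X j * ln (?u j + h * (?v j - ?u j))"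
  have "DERIV ?\<phi> 0 :> (\<Sum>j\<in>D. X j * ((?v j - ?u j) / ?u j))"
    using nbhd_mat_vec(2)[OF U]
    by (auto intro!: derivative_eq_intros sum.cong simp: field_simps)
  from DERIV_pos_inc_right[OF this] * obtain d' where
    d': "0 < d'" "\<forall>h>0. h < d' \<longrightarrow> ?\<phi> 0 < ?\<phi> (0 + h)"
    by (auto simp only: not_le)
  define h where "h = min d (d' / 2)"
  have h: "0 < h" "h \<le> d" "h < d'" using seg(1) d'(1) by (auto simp: h_def)
  have "?\<phi> h \<le> ?\<phi> 0"
    using mle seg(2)[OF h(1,2)] by (auto simp: local_mle_def mat_vec_segment dest!: bspec)
  moreover have "?\<phi> 0 < ?\<phi> h"
    using d'(2)[rule_format, OF h(1,3)] by simp
  ultimately show False by simp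
qed

lemma local_mle_first_order_truth:
  assumes mle: "local_mle X U"
  shows "(\<Sum>j\<in>D. X j * ((P j - mat_vec K A U j) / mat_vec K A U j)) \<le> 0"
proof -
  have U: "U \<in> nbhd" using mle by (simp add: local_mle_def)
  have "(\<lambda>k. U k + h * (truth k - U k)) \<in> nbhd" if h: "0 < h" "h \<le> 1" for h
  proof -
    have "(\<Sum>k\<in>S. U k + h * (truth k - U k)) = (\<Sum>k\<in>S. U k) + h * ((\<Sum>k\<in>S. truth k) - (\<Sum>k\<in>S. U k))"
      by (simp add: sum.distrib sum_distrib_left[symmetric] sum_subtractf[symmetric])
    moreover have "(\<Sum>k\<in>S. \<bar>U k + h * (truth k - U k) - T k\<bar>) \<le> (\<Sum>k\<in>S. \<bar>U k - T k\<bar>)"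
    proof (rule sum_mono)
      fix k assume "k \<in> S"
      then have "U k + h * (truth k - U k) - T k = (1 - h) * (U k - T k)"
        by (simp add: truth_def algebra_simps)
      then show "\<bar>U k + h * (truth k - U k) - T k\<bar> \<le> \<bar>U k - T k\<bar>"
        using h by (simp add: abs_mult mult_left_le_one_le)
    qed
    ultimately show ?thesis
      using U truth_nbhd by (auto simp: nbhd_def)
  qed
  then show ?thesis
    using local_mle_first_order[OF mle, of 1 truth]
    by (simp add: mat_vec_truth)
qed

text \<open>
  In the interior of the ball a short step towards any vertex of the face is feasible, and the
  derivative in the direction of vertex \<open>k\<close> is the score of \<open>k\<close> minus 1.
\<close>

lemma local_mle_score_on_support:
  assumes mle: "local_mle X U"
    and interior: "(\<Sum>k\<in>S. \<bar>U k - T k\<bar>) < Tm / 2"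
    and X: "(\<Sum>j\<in>D. X j) = 1"
    and k: "k \<in> S"
  shows "(\<Sum>j\<in>D. X j * (A j k / mat_vec K A U j)) \<le> 1"
proof -
  have U: "U \<in> nbhd" using mle by (simp add: local_mle_def)
  define V where "V l = (if l = k then 1 else 0 :: real)" for l
  have VA: "mat_vec K A V j = A j k" for j
  proof -
    have "mat_vec K A V j = (\<Sum>l<K. if l = k then A j l else 0)"
      unfolding mat_vec_def V_def by (rule sum.cong) auto
    then show ?thesis using S_less[OF k] by simp
  qed
  have sumV: "(\<Sum>l\<in>S. V l) = 1" "(\<Sum>l\<in>S. \<bar>V l\<bar>) = 1"
  proof -
    show "(\<Sum>l\<in>S. V l) = 1" unfolding V_def using k by simp
    then show "(\<Sum>l\<in>S. \<bar>V l\<bar>) = 1" by (simp add: V_def)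
  qed
  have sumU: "(\<Sum>l\<in>S. U l) = 1" using U by (simp add: nbhd_def)
  have "(\<Sum>l\<in>S. \<bar>U l\<bar>) = (\<Sum>l\<in>S. U l)"
    using nbhd_component(2)[OF U] by (intro sum.cong) (auto simp: less_imp_le)
  then have dist: "(\<Sum>l\<in>S. \<bar>V l - U l\<bar>) \<le> 2"
    using sum_mono[of S "\<lambda>l. \<bar>V l - U l\<bar>" "\<lambda>l. \<bar>V l\<bar> + \<bar>U l\<bar>"] sumU sumV by (simp add: sum.distrib)
  \<comment> \<open>Two points of the simplex are at \<open>l\<^sub>1\<close>-distance at most 2, which fixes the admissible
    step.\<close>
  define d where "d = (Tm / 2 - (\<Sum>k\<in>S. \<bar>U k - T k\<bar>)) / 2"
  have "(\<lambda>l. U l + h * (V l - U l)) \<in> nbhd" if h: "0 < h" "h \<le> d" for h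
  proof -
    have "(\<Sum>l\<in>S. U l + h * (V l - U l)) = 1"
      by (simp add: sum.distrib sum_distrib_left[symmetric] sum_subtractf sumU sumV)
    moreover have "(\<Sum>l\<in>S. \<bar>U l + h * (V l - U l) - T l\<bar>) \<le> (\<Sum>l\<in>S. \<bar>U l - T l\<bar> + h * \<bar>V l - U l\<bar>)"
    proof (rule sum_mono)
      fix l
      have "\<bar>(U l - T l) + h * (V l - U l)\<bar> \<le> \<bar>U l - T l\<bar> + \<bar>h * (V l - U l)\<bar>" by (rule abs_triangle_ineq)
      then show "\<bar>U l + h * (V l - U l) - T l\<bar> \<le> \<bar>U l - T l\<bar> + h * \<bar>V l - U l\<bar>"
        using h by (simp only: abs_mult abs_of_pos add_diff_eq diff_add_eq)
    qed
    moreover have "\<dots> \<le> Tm / 2"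
      using mult_mono[OF h(2) dist] h
      by (simp add: sum.distrib sum_distrib_left[symmetric] sum_nonneg d_def)
    ultimately show ?thesis
      using U k by (auto simp: nbhd_def V_def)
  qed
  moreover have "0 < d" using interior by (simp add: d_def)
  ultimately have "(\<Sum>j\<in>D. X j * ((A j k - mat_vec K A U j) / mat_vec K A U j)) \<le> 0"
    using local_mle_first_order[OF mle, of d V] by (simp add: VA)
  moreover have "X j * ((A j k - mat_vec K A U j) / mat_vec K A U j) = X j * (A j k / mat_vec K A U j) - X j" if "j \<in> D" for j
    using nbhd_mat_vec(2)[OF U that] by (simp add: field_simps)
  ultimately show ?thesis
    using X by (simp add: sum_subtractf)
qed

lemma loglik_eq:
  assumes X: "\<And>j. 0 \<le> X j" "\<And>j. j \<notin> D \<Longrightarrow> X j = 0"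
    and V: "\<And>j. j \<in> D \<Longrightarrow> 0 < X j \<Longrightarrow> 0 < mat_vec K A V j"
  shows "loglik p K A X V = ereal (\<Sum>j\<in>D. X j * ln (mat_vec K A V j))"
proof -
  have J: "j \<in> D" if "0 < X j" for j using that X(2)[of j] by force
  have "loglik p K A X V = (\<Sum>j | j < p \<and> 0 < X j. ereal (X j * ln (mat_vec K A V j)))"
    unfolding loglik_def using V J by (intro sum.cong) auto
  also have "\<dots> = ereal (\<Sum>j | j < p \<and> 0 < X j. X j * ln (mat_vec K A V j))"
    by simp
  also have "(\<Sum>j | j < p \<and> 0 < X j. X j * ln (mat_vec K A V j)) = (\<Sum>j\<in>D. X j * ln (mat_vec K A V j))"
    by (rule sum.mono_neutral_left) (use J D_less X(1) in \<open>auto simp: order.strict_iff_order\<close>)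
  finally show ?thesis .
qed

lemma loglik_minus_infinity:
  assumes j: "j < p" "0 < X j" "mat_vec K A V j \<le> 0"
  shows "loglik p K A X V = - \<infinity>"
proof -
  let ?J = "{j. j < p \<and> 0 < X j}"
  let ?f = "\<lambda>j. ereal (X j) * (if mat_vec K A V j > 0 then ereal (ln (mat_vec K A V j)) else -\<infinity>)"
  have "loglik p K A X V = ?f j + sum ?f (?J - {j})"
    unfolding loglik_def by (rule sum.remove) (use j in auto)
  moreover have "?f j = - \<infinity>" using j by simp
  moreover have "sum ?f (?J - {j}) \<noteq> \<infinity>"
    by (subst sum_Pinfty) auto
  ultimately show ?thesis by simp
qed

text \<open>
  The tangent inequality \<open>ln x \<le> x - 1\<close> bounds the gain of a competitor \<open>V\<close> over \<open>U\<close> by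
  \<open>(\<Sum>k. V k * score k) - 1\<close>. With scores at most 1 this is negative as soon as \<open>V\<close> charges an index
  whose score is below 1. Observed words of probability 0 under \<open>V\<close> make its likelihood \<open>-\<infinity>\<close> and are
  excluded first.
\<close>

lemma supp_mle_subset:
  assumes X: "\<And>j. 0 \<le> X j" "\<And>j. j \<notin> D \<Longrightarrow> X j = 0" "(\<Sum>j\<in>D. X j) = 1"
    and U: "U \<in> simplex_vecs K" "\<And>j. j \<in> D \<Longrightarrow> 0 < mat_vec K A U j"
    and le: "\<And>k. k \<in> S \<Longrightarrow> (\<Sum>j\<in>D. X j * (A j k / mat_vec K A U j)) \<le> 1"
    and less: "\<And>k. k < K \<Longrightarrow> k \<notin> S \<Longrightarrow> (\<Sum>j\<in>D. X j * (A j k / mat_vec K A U j)) < 1"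
    and mle: "is_mle p K A X V"
  shows "supp K V \<subseteq> S"
proof (rule ccontr)
  assume "\<not> ?thesis"
  then obtain k0 where k0: "k0 < K" "k0 \<notin> S" "V k0 \<noteq> 0" by (auto simp: supp_def)
  have V: "\<And>k. k < K \<Longrightarrow> 0 \<le> V k" "(\<Sum>k<K. V k) = 1"
    using mle by (auto simp: is_mle_def is_arg_max_def simplex_vecs_def)
  let ?u = "mat_vec K A U" and ?v = "mat_vec K A V"
  let ?g = "\<lambda>k. \<Sum>j\<in>D. X j * (A j k / ?u j)"
  have not_less: "\<not> loglik p K A X V < loglik p K A X U"
    using mle U(1) by (auto simp: is_mle_def is_arg_max_def)
  have llU: "loglik p K A X U = ereal (\<Sum>j\<in>D. X j * ln (?u j))"
    by (rule loglik_eq) (use X U in auto)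
  have v: "0 < ?v j" if "j \<in> D" "0 < X j" for j
  proof (rule ccontr)
    assume "\<not> 0 < ?v j"
    then have "loglik p K A X V = - \<infinity>"
      using that D_less by (intro loglik_minus_infinity[of j]) auto
    then show False using not_less llU by simp
  qed
  have "loglik p K A X V = ereal (\<Sum>j\<in>D. X j * ln (?v j))"
    by (rule loglik_eq) (use X v in auto)
  then have "(\<Sum>j\<in>D. X j * ln (?u j)) \<le> (\<Sum>j\<in>D. X j * ln (?v j))"
    using not_less llU by simp
  then have "0 \<le> (\<Sum>j\<in>D. X j * ln (?v j) - X j * ln (?u j))"
    by (simp add: sum_subtractf)
  also have "\<dots> \<le> (\<Sum>j\<in>D. X j * (?v j / ?u j) - X j)"
  proof (rule sum_mono)
    fix j assume j: "j \<in> D"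
    show "X j * ln (?v j) - X j * ln (?u j) \<le> X j * (?v j / ?u j) - X j"
    proof (cases "X j = 0")
      case False
      then have "0 < X j" using X(1)[of j] by simp
      note v[OF j this] U(2)[OF j]
      then have "ln (?v j) - ln (?u j) \<le> ?v j / ?u j - 1"
        using ln_le_minus_one[of "?v j / ?u j"] by (simp add: ln_div)
      from mult_left_mono[OF this X(1)[of j]] show ?thesis by (simp add: right_diff_distrib)
    qed simp
  qed
  also have "\<dots> = (\<Sum>j\<in>D. \<Sum>k<K. V k * (X j * (A j k / ?u j))) - 1"
    by (simp add: sum_subtractf X(3) mat_vec_def sum_distrib_left sum_divide_distrib mult_ac)
  also have "\<dots> = (\<Sum>k<K. V k * ?g k) - 1"
    by (subst sum.swap) (simp add: sum_distrib_left)
  also have "\<dots> < (\<Sum>k<K. V k) - 1"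
  proof -
    have g: "?g k \<le> 1" if "k < K" for k
      using le[of k] less[of k] that by (cases "k \<in> S") auto
    have "(\<Sum>k<K. V k * ?g k) < (\<Sum>k<K. V k)"
    proof (rule sum_strict_mono_ex1)
      show "\<forall>k\<in>{..<K}. V k * ?g k \<le> V k"
        using g V(1) by (auto intro: mult_left_le)
      have "0 < V k0" using V(1)[OF k0(1)] k0(3) by simp
      then have "V k0 * ?g k0 < V k0" using mult_strict_left_mono[OF less[OF k0(1,2)], of "V k0"] by simp
      then show "\<exists>k\<in>{..<K}. V k * ?g k < V k" using k0(1) by auto
    qed simp
    then show ?thesis by simp
  qed
  also have "\<dots> = 0" by (simp add: V(2))
  finally show False by simp
qed

lemma nbhd_simplex: "U \<in> nbhd \<Longrightarrow> U \<in> simplex_vecs K"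
proof -
  assume U: "U \<in> nbhd"
  have "(\<Sum>k<K. U k) = (\<Sum>k\<in>S. U k)"
    by (rule sum.mono_neutral_right) (use U supp_subset in \<open>auto simp: nbhd_def\<close>)
  moreover have "0 \<le> U k" for k
    using nbhd_component(2)[OF U, of k] U by (cases "k \<in> S") (auto simp: nbhd_def)
  ultimately show ?thesis using U by (auto simp: simplex_vecs_def nbhd_def)
qed

text \<open>
  With \<open>Q = \<Sum>P w\<^sup>2\<close> and \<open>Y = \<Sum>X w\<^sup>2\<close>, optimality towards the truth gives \<open>(2/3) Y \<le> sqrt Q * \<eta>\<close>, and
  the Gram hypothesis gives \<open>\<bar>Y - Q\<bar> \<le> Q / 4\<close>. Solving the two inequalities yields \<open>sqrt Q \<le> 2 \<eta>\<close>, hence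
  the coefficient bound, and \<open>Y \<le> 3 \<eta>\<^sup>2\<close>.
\<close>

lemma local_mle_deviation:
  assumes mle: "local_mle X U"
    and X: "\<And>j. 0 \<le> X j"
    and kap: "0 < kap"
      "\<And>v. kap * (\<Sum>k\<in>S. \<bar>v k\<bar>) \<le> sqrt (\<Sum>j\<in>D. P j * (\<Sum>k\<in>S. v k * (A j k / P j))\<^sup>2)"
    and gram: "\<And>k l. k \<in> S \<Longrightarrow> l \<in> S \<Longrightarrow>
      \<bar>\<Sum>j\<in>D. (X j - P j) * (A j k / P j * (A j l / P j))\<bar> \<le> kap\<^sup>2 / 4"
    and \<eta>: "0 \<le> \<eta>"
    and noise: "\<And>v. (\<Sum>j\<in>D. (X j - P j) * (\<Sum>k\<in>S. v k * (A j k / P j)))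
        \<le> sqrt (\<Sum>j\<in>D. P j * (\<Sum>k\<in>S. v k * (A j k / P j))\<^sup>2) * \<eta>"
  shows "kap * (\<Sum>k\<in>S. \<bar>U k - T k\<bar>) \<le> 2 * \<eta>"
    and "(\<Sum>j\<in>D. X j * ((mat_vec K A U j - P j) / P j)\<^sup>2) \<le> 3 * \<eta>\<^sup>2"
proof -
  have U: "U \<in> nbhd" using mle by (simp add: local_mle_def)
  define d where "d k = U k - T k" for k
  define w where "w j = (\<Sum>k\<in>S. d k * (A j k / P j))" for j
  define Q where "Q = (\<Sum>j\<in>D. P j * (w j)\<^sup>2)"
  define Y where "Y = (\<Sum>j\<in>D. X j * (w j)\<^sup>2)"
  have w: "mat_vec K A U j - P j = P j * w j" if "j \<in> D" for j
  proof -
    have "mat_vec K A U j - P j = (\<Sum>k\<in>S. d k * A j k)"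
      by (simp add: mat_vec_nbhd[OF U] P_eq d_def left_diff_distrib sum_subtractf)
    also have "\<dots> = P j * w j"
      using P_pos[OF that] by (simp add: w_def sum_distrib_left)
    finally show ?thesis .
  qed
  have w_half: "\<bar>w j\<bar> \<le> 1 / 2" if "j \<in> D" for j
    using nbhd_mat_vec(1)[OF U that] P_pos[OF that] by (simp add: w[OF that] abs_mult)
  have Q0: "0 \<le> Q"
    unfolding Q_def using P_pos by (intro sum_nonneg mult_nonneg_nonneg) (auto simp: less_imp_le)
  have kapQ: "kap * (\<Sum>k\<in>S. \<bar>d k\<bar>) \<le> sqrt Q"
    using kap(2)[of d] by (simp add: Q_def w_def)
  \<comment> \<open>Both \<open>A U\<close> and \<open>P\<close> have total mass 1 on \<open>D\<close>, so the linear term sees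
    only \<open>X - P\<close>.\<close>
  have Pw: "(\<Sum>j\<in>D. P j * w j) = 0"
  proof -
    have "(\<Sum>j\<in>D. P j * w j) = (\<Sum>j\<in>D. mat_vec K A U j) - (\<Sum>j\<in>D. P j)"
      by (simp add: sum_subtractf[symmetric] w)
    also have "(\<Sum>j\<in>D. mat_vec K A U j) = 1"
      using U by (simp add: mat_vec_nbhd sum_D_S) (simp add: nbhd_def)
    finally show ?thesis by (simp add: sum_P)
  qed
  have "0 \<le> (\<Sum>j\<in>D. X j * (w j / (1 + w j)))"
  proof -
    have "(P j - mat_vec K A U j) / mat_vec K A U j = - (w j / (1 + w j))" if "j \<in> D" for j
    proof -
      have "mat_vec K A U j = P j * (1 + w j)" using w[OF that] by (simp add: algebra_simps)
      then have "(P j - mat_vec K A U j) / mat_vec K A U j = (P j * (- w j)) / (P j * (1 + w j))"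
        by (simp add: algebra_simps)
      then show ?thesis using P_pos[OF that] by simp
    qed
    then show ?thesis
      using local_mle_first_order_truth[OF mle] by (simp add: sum_negf)
  qed
  also have "\<dots> \<le> (\<Sum>j\<in>D. X j * w j - 2 / 3 * (X j * (w j)\<^sup>2))"
  proof (rule sum_mono)
    fix j assume j: "j \<in> D"
    \<comment> \<open>\<open>w / (1 + w) = w - w\<^sup>2 / (1 + w)\<close>, and \<open>1 + w \<le> 3/2\<close>.\<close>
    have "(w j)\<^sup>2 * (2 / 3 * (1 + w j)) \<le> (w j)\<^sup>2 * 1"
      using w_half[OF j] by (intro mult_left_mono) auto
    then have "w j \<le> (w j - 2 / 3 * (w j)\<^sup>2) * (1 + w j)"
      by (simp add: algebra_simps power2_eq_square)
    then have "w j / (1 + w j) \<le> w j - 2 / 3 * (w j)\<^sup>2"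
      using w_half[OF j] by (subst pos_divide_le_eq) (auto simp: abs_le_iff)
    from mult_left_mono[OF this X[of j]]
    show "X j * (w j / (1 + w j)) \<le> X j * w j - 2 / 3 * (X j * (w j)\<^sup>2)"
      by (simp add: algebra_simps)
  qed
  also have "\<dots> = (\<Sum>j\<in>D. (X j - P j) * w j) - 2 / 3 * Y"
    using Pw by (simp add: sum_subtractf sum_distrib_left Y_def left_diff_distrib)
  also have "(\<Sum>j\<in>D. (X j - P j) * w j) \<le> sqrt Q * \<eta>"
    unfolding w_def Q_def by (rule noise)
  finally have Y_upper: "2 / 3 * Y \<le> sqrt Q * \<eta>" by simp
  have "Y - Q = (\<Sum>j\<in>D. (X j - P j) * (w j)\<^sup>2)"
    by (simp add: Q_def Y_def sum_subtractf[symmetric] algebra_simps)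
  also have "\<dots> = (\<Sum>j\<in>D. \<Sum>k\<in>S. \<Sum>l\<in>S. d k * d l * ((X j - P j) * (A j k / P j * (A j l / P j))))"
    by (intro sum.cong refl)
       (simp only: w_def power2_eq_square sum_product sum_distrib_left mult_ac)
  also have "\<dots> = (\<Sum>k\<in>S. \<Sum>l\<in>S. d k * d l * (\<Sum>j\<in>D. (X j - P j) * (A j k / P j * (A j l / P j))))"
    by (subst sum.swap, rule sum.cong[OF refl], subst sum.swap) (simp add: sum_distrib_left)
  finally have "\<bar>Y - Q\<bar> \<le> (\<Sum>k\<in>S. \<bar>\<Sum>l\<in>S. d k * d l * (\<Sum>j\<in>D. (X j - P j) * (A j k / P j * (A j l / P j)))\<bar>)"
    by (simp only: sum_abs)
  also have "\<dots> \<le> (\<Sum>k\<in>S. \<Sum>l\<in>S. \<bar>d k\<bar> * \<bar>d l\<bar> * (kap\<^sup>2 / 4))"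
  proof (rule sum_mono)
    fix k assume k: "k \<in> S"
    show "\<bar>\<Sum>l\<in>S. d k * d l * (\<Sum>j\<in>D. (X j - P j) * (A j k / P j * (A j l / P j)))\<bar>
        \<le> (\<Sum>l\<in>S. \<bar>d k\<bar> * \<bar>d l\<bar> * (kap\<^sup>2 / 4))"
    proof (rule order_trans[OF sum_abs sum_mono])
      fix l assume "l \<in> S"
      from mult_left_mono[OF gram[OF k this], of "\<bar>d k\<bar> * \<bar>d l\<bar>"]
      show "\<bar>d k * d l * (\<Sum>j\<in>D. (X j - P j) * (A j k / P j * (A j l / P j)))\<bar>
          \<le> \<bar>d k\<bar> * \<bar>d l\<bar> * (kap\<^sup>2 / 4)"
        by (simp add: abs_mult)
    qed
  qed
  also have "\<dots> = (kap * (\<Sum>k\<in>S. \<bar>d k\<bar>))\<^sup>2 / 4"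
    by (simp add: power_mult_distrib power2_eq_square sum_product sum_distrib_left sum_distrib_right
        sum_divide_distrib mult_ac)
  also have "\<dots> \<le> (sqrt Q)\<^sup>2 / 4"
    using kapQ kap(1) by (intro divide_right_mono power_mono) (auto simp: sum_nonneg)
  finally have "\<bar>Y - Q\<bar> \<le> Q / 4" using Q0 by simp
  then have "3 / 4 * Q \<le> Y" using Q0 by linarith
  then have "Q \<le> 2 * (sqrt Q * \<eta>)" using Y_upper by linarith
  then have "sqrt Q * sqrt Q \<le> sqrt Q * (2 * \<eta>)" using Q0 by simp
  then have sqrtQ: "sqrt Q \<le> 2 * \<eta>"
    using \<eta> Q0 mult_le_cancel_left_pos[of "sqrt Q" "sqrt Q" "2 * \<eta>"] by (cases "Q = 0") simp_all
  show "kap * (\<Sum>k\<in>S. \<bar>U k - T k\<bar>) \<le> 2 * \<eta>"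
    using kapQ sqrtQ by (simp add: d_def)
  have "(\<Sum>j\<in>D. X j * ((mat_vec K A U j - P j) / P j)\<^sup>2) = Y"
    unfolding Y_def by (intro sum.cong refl) (use P_pos in \<open>force simp: w\<close>)
  also have "\<dots> \<le> 3 / 2 * (2 * \<eta> * \<eta>)"
    using Y_upper mult_right_mono[OF sqrtQ \<eta>] by linarith
  finally show "(\<Sum>j\<in>D. X j * ((mat_vec K A U j - P j) / P j)\<^sup>2) \<le> 3 * \<eta>\<^sup>2"
    by (simp add: power2_eq_square)
qed

section \<open>Deviation events\<close>

text \<open>
  One factor \<open>A j k / P j\<close> is bounded by \<open>B\<close>; the weight \<open>P j\<close> cancels the other denominator and leaves
  a column sum. The second moment is therefore linear, not quadratic, in \<open>B\<close>.
\<close>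

lemma second_moment_ratio:
  assumes k: "k < K" and B: "\<And>j. j \<in> D \<Longrightarrow> A j k / P j \<le> B" "0 \<le> B"
  shows "(\<Sum>j\<in>D. P j * (A j k / P j)\<^sup>2) \<le> B"
proof -
  have "(\<Sum>j\<in>D. P j * (A j k / P j)\<^sup>2) \<le> (\<Sum>j\<in>D. B * A j k)"
  proof (rule sum_mono)
    fix j assume j: "j \<in> D"
    have "P j * (A j k / P j)\<^sup>2 = A j k / P j * A j k"
      using P_pos[OF j] by (simp add: power2_eq_square)
    also have "\<dots> \<le> B * A j k"
      using B(1)[OF j] A_nonneg[OF D_less[OF j] k] by (rule mult_right_mono)
    finally show "P j * (A j k / P j)\<^sup>2 \<le> B * A j k" .
  qed
  also have "\<dots> \<le> B * (\<Sum>j<p. A j k)"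
    unfolding sum_distrib_left[symmetric]
    using B(2) k A_nonneg D_less by (intro mult_left_mono sum_mono2) auto
  finally show ?thesis using A_col_sum[OF k] by simp
qed

text \<open>
  Products of two ratios have size at most \<open>Tm\<^sup>-\<^sup>2\<close>, but second moment only \<open>Tm\<^sup>-\<^sup>3\<close>. This exponent is the
  one in the sample size condition.
\<close>

lemma prob_gram:
  assumes N: "0 < N" and t: "0 \<le> t"
  shows "measure_pmf.prob (freq_pmf p N P)
     {X. \<exists>k\<in>S. \<exists>l\<in>S. 2 * sqrt ((1 / Tm) ^ 3 * t / real N) + (1 / Tm)\<^sup>2 * t / real N
        < \<bar>\<Sum>j\<in>D. (X j - P j) * (A j k / P j * (A j l / P j))\<bar>} \<le> 2 * (real (card S))\<^sup>2 * exp (- t)"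
proof -
  let ?E = "\<lambda>(k, l). {X. 2 * sqrt ((1 / Tm) ^ 3 * t / real N) + (1 / Tm)\<^sup>2 * t / real N
        < \<bar>\<Sum>j\<in>D. (X j - P j) * (A j k / P j * (A j l / P j))\<bar>}"
  have "measure_pmf.prob (freq_pmf p N P) (\<Union>kl\<in>S \<times> S. ?E kl) \<le> real (card (S \<times> S)) * (2 * exp (- t))"
  proof (rule prob_UN_le)
    fix kl assume "kl \<in> S \<times> S"
    then obtain k l where kl: "kl = (k, l)" "k \<in> S" "l \<in> S" by auto
    have r: "0 \<le> A j k / P j" "A j k / P j \<le> 1 / Tm" if "j \<in> D" "k \<in> S" for j k
      using ratio_nonneg ratio_le_on_support S_less that by auto
    have "measure_pmf.prob (freq_pmf p N P) {X. 2 * sqrt ((1 / Tm) ^ 3 * t / real N) + (1 / Tm)\<^sup>2 * t / real N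
        < \<bar>\<Sum>j\<in>D. (X j - P j) * (A j k / P j * (A j l / P j))\<bar>} \<le> 2 * exp (- t)"
    proof (rule bernstein_freq_pmf_abs[OF P_simplex N _ _ t])
      show "\<bar>A j k / P j * (A j l / P j)\<bar> \<le> (1 / Tm)\<^sup>2" if "j \<in> D" for j
        unfolding power2_eq_square abs_mult using r[OF that kl(2)] r[OF that kl(3)] Tm_pos
        by (intro mult_mono) (simp_all only: abs_of_nonneg abs_ge_zero zero_le_divide_1_iff less_imp_le)
      have "(\<Sum>j\<in>D. P j * (A j k / P j * (A j l / P j))\<^sup>2) \<le> (\<Sum>j\<in>D. (1 / Tm)\<^sup>2 * (P j * (A j k / P j)\<^sup>2))"
      proof (rule sum_mono)
        fix j assume j: "j \<in> D"
        have "(A j l / P j)\<^sup>2 \<le> (1 / Tm)\<^sup>2"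
          using r[OF j kl(3)] by (intro power_mono) auto
        from mult_right_mono[OF this, of "P j * (A j k / P j)\<^sup>2"] P_pos[OF j]
        show "P j * (A j k / P j * (A j l / P j))\<^sup>2 \<le> (1 / Tm)\<^sup>2 * (P j * (A j k / P j)\<^sup>2)"
          by (simp add: power_mult_distrib power_divide mult_ac)
      qed
      also have "\<dots> \<le> (1 / Tm)\<^sup>2 * (1 / Tm)"
        unfolding sum_distrib_left[symmetric]
        using Tm_pos ratio_le_on_support kl(2) S_less by (intro mult_left_mono second_moment_ratio) auto
      finally show "(\<Sum>j\<in>D. P j * (A j k / P j * (A j l / P j))\<^sup>2) \<le> (1 / Tm) ^ 3"
        by (simp add: power2_eq_square power3_eq_cube)
    qed (use Tm_pos in auto)
    then show "measure_pmf.prob (freq_pmf p N P) (?E kl) \<le> 2 * exp (- t)"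
      by (simp add: kl(1))
  qed auto
  moreover have "(\<Union>kl\<in>S \<times> S. ?E kl) = {X. \<exists>k\<in>S. \<exists>l\<in>S. 2 * sqrt ((1 / Tm) ^ 3 * t / real N) + (1 / Tm)\<^sup>2 * t / real N
        < \<bar>\<Sum>j\<in>D. (X j - P j) * (A j k / P j * (A j l / P j))\<bar>}" by blast
  ultimately show ?thesis by (simp add: card_cartesian_product power2_eq_square mult_ac)
qed

text \<open>
  Each of the at most \<open>card S\<close> test functions has second moment 1 by normalization. Its coefficients
  have \<open>l\<^sub>1\<close> norm at most \<open>1 / \<kappa>\<close> by the definition of \<open>\<kappa>\<close>, which bounds its values by
  \<open>1 / (\<kappa> Tm)\<close>.
\<close>

lemma prob_noise:
  assumes N: "0 < N" and t: "0 \<le> t" and kap: "0 < kap"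
      "\<And>v. kap * (\<Sum>k\<in>S. \<bar>v k\<bar>) \<le> sqrt (\<Sum>j\<in>D. P j * (\<Sum>k\<in>S. v k * (A j k / P j))\<^sup>2)"
  shows "measure_pmf.prob (freq_pmf p N P)
     {X. \<exists>v. sqrt (\<Sum>j\<in>D. P j * (\<Sum>k\<in>S. v k * (A j k / P j))\<^sup>2)
           * (sqrt (real (card S)) * (2 * sqrt (t / real N) + 1 / (kap * Tm) * t / real N))
        < (\<Sum>j\<in>D. (X j - P j) * (\<Sum>k\<in>S. v k * (A j k / P j)))} \<le> 2 * real (card S) * exp (- t)"
    (is "measure_pmf.prob ?M ?F \<le> _")
proof -
  define \<tau> where "\<tau> = 2 * sqrt (1 * t / real N) + 1 / (kap * Tm) * t / real N"
  have \<tau>: "0 \<le> \<tau>" using t kap(1) Tm_pos by (simp add: \<tau>_def)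
  obtain n :: nat and e b where n: "n \<le> card S"
    and e1: "\<And>i. i < n \<Longrightarrow> (\<Sum>j\<in>D. P j * (e i j)\<^sup>2) = 1"
    and eb: "\<And>i j. i < n \<Longrightarrow> j \<in> D \<Longrightarrow> e i j = (\<Sum>k\<in>S. b i k * (A j k / P j))"
    and test: "\<And>z v \<tau>. (\<And>i. i < n \<Longrightarrow> \<bar>\<Sum>j\<in>D. z j * e i j\<bar> \<le> \<tau>) \<Longrightarrow> 0 \<le> \<tau> \<Longrightarrow>
      (\<Sum>j\<in>D. z j * (\<Sum>k\<in>S. v k * (A j k / P j)))
        \<le> sqrt (\<Sum>j\<in>D. P j * (\<Sum>k\<in>S. v k * (A j k / P j))\<^sup>2) * (sqrt (real (card S)) * \<tau>)"
    by (rule finite_test_functions[of D P S "\<lambda>k j. A j k / P j"]) (auto dest: P_pos)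
  let ?E = "\<lambda>i. {X. \<tau> < \<bar>\<Sum>j\<in>D. (X j - P j) * e i j\<bar>}"
  have "measure_pmf.prob ?M (\<Union>i<n. ?E i) \<le> real (card {..<n}) * (2 * exp (- t))"
  proof (rule prob_UN_le)
    fix i assume "i \<in> {..<n}"
    then have i: "i < n" by simp
    show "measure_pmf.prob ?M (?E i) \<le> 2 * exp (- t)"
      unfolding \<tau>_def
    proof (rule bernstein_freq_pmf_abs[OF P_simplex N _ _ t])
      have "(\<Sum>j\<in>D. P j * (\<Sum>k\<in>S. b i k * (A j k / P j))\<^sup>2) = 1"
        using e1[OF i] eb[OF i] by simp
      then have r: "(\<Sum>k\<in>S. \<bar>b i k\<bar>) \<le> 1 / kap"
        using kap(2)[of "b i"] kap(1) by (simp add: field_simps)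
      show "\<bar>e i j\<bar> \<le> 1 / (kap * Tm)" if j: "j \<in> D" for j
      proof -
        have "\<bar>b i k\<bar> \<le> 1 / kap" if "k \<in> S" for k
          by (rule order_trans[OF _ r], rule member_le_sum) (use that in auto)
        then have "\<bar>\<Sum>k\<in>S. b i k * A j k\<bar> \<le> 1 / kap / Tm * P j"
          by (rule combination_le_P[OF j])
        moreover have "e i j = (\<Sum>k\<in>S. b i k * A j k) / P j"
          by (simp add: eb[OF i j] sum_divide_distrib)
        ultimately show ?thesis
          using P_pos[OF j] by (simp add: pos_divide_le_eq)
      qed
      show "(\<Sum>j\<in>D. P j * (e i j)\<^sup>2) \<le> 1" using e1[OF i] by simp
    qed (use kap(1) Tm_pos in auto)
  qed auto
  also have "real (card {..<n}) * (2 * exp (- t)) \<le> real (card S) * (2 * exp (- t))"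
    using n by (intro mult_right_mono) auto
  finally have *: "measure_pmf.prob ?M (\<Union>i<n. ?E i) \<le> 2 * real (card S) * exp (- t)" by simp
  have "?F \<subseteq> (\<Union>i<n. ?E i)"
  proof
    fix X assume X: "X \<in> ?F"
    show "X \<in> (\<Union>i<n. ?E i)"
    proof (rule ccontr)
      assume "X \<notin> (\<Union>i<n. ?E i)"
      then have "\<bar>\<Sum>j\<in>D. (X j - P j) * e i j\<bar> \<le> \<tau>" if "i < n" for i
        using that by (auto simp: not_less)
      from test[OF this \<tau>] X show False
        by (auto simp: \<tau>_def not_le[symmetric])
    qed
  qed
  then have "measure_pmf.prob ?M ?F \<le> measure_pmf.prob ?M (\<Union>i<n. ?E i)"
    by (rule measure_pmf.finite_measure_mono) simp
  with * show ?thesis by linarith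
qed

lemma prob_off_support:
  assumes N: "0 < N" and t: "0 \<le> t" and B: "0 < B"
    "\<And>j k. j \<in> D \<Longrightarrow> k \<in> {..<K} - S \<Longrightarrow> A j k / P j \<le> B"
  shows "measure_pmf.prob (freq_pmf p N P)
     {X. \<exists>k\<in>{..<K} - S. 2 * sqrt (B * t / real N) + B * t / real N
        < (\<Sum>j\<in>D. (X j - P j) * (A j k / P j))} \<le> real K * exp (- t)"
proof -
  let ?E = "\<lambda>k. {X. 2 * sqrt (B * t / real N) + B * t / real N < (\<Sum>j\<in>D. (X j - P j) * (A j k / P j))}"
  have "measure_pmf.prob (freq_pmf p N P) (\<Union>k\<in>{..<K} - S. ?E k) \<le> real (card ({..<K} - S)) * exp (- t)"
  proof (rule prob_UN_le)
    fix k assume k: "k \<in> {..<K} - S"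
    show "measure_pmf.prob (freq_pmf p N P) (?E k) \<le> exp (- t)"
      by (rule bernstein_freq_pmf[OF P_simplex N B(1) _ t])
        (use B k in \<open>auto intro!: second_moment_ratio\<close>)
  qed auto
  also have "\<dots> \<le> real K * exp (- t)"
    using card_mono[of "{..<K}" "{..<K} - S"] by (intro mult_right_mono) auto
  finally show ?thesis
    by (rule order_trans[rotated]) (intro measure_pmf.finite_measure_mono, auto)
qed

abbreviation "off_mass k \<equiv> \<Sum>j\<in>{..<p} - D. A j k"

lemma off_mass_eq:
  assumes "k < K"
  shows "off_mass k = 1 - (\<Sum>j\<in>D. A j k)"
proof -
  have "D \<subseteq> {..<p}" using D_less by auto
  from sum.subset_diff[OF this, of "\<lambda>j. A j k"] show ?thesis
    using A_col_sum[OF assms] by simp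
qed

text \<open>
  The deterministic core. The score of \<open>k \<notin> S\<close> at the candidate exceeds the one at the truth by at most
  \<open>2 B \<Sum>X \<bar>w\<bar>\<close>, and \<open>\<Sum>X \<bar>w\<bar> \<le> sqrt (\<Sum>X w\<^sup>2)\<close>, so the rate of \<open>w\<close> in the empirical \<open>L\<^sup>2\<close> norm suffices.
\<close>

lemma supp_mle_subset_of_deviations:
  assumes X: "\<And>j. 0 \<le> X j" "\<And>j. j \<notin> D \<Longrightarrow> X j = 0" "(\<Sum>j\<in>D. X j) = 1"
    and kap: "0 < kap"
      "\<And>v. kap * (\<Sum>k\<in>S. \<bar>v k\<bar>) \<le> sqrt (\<Sum>j\<in>D. P j * (\<Sum>k\<in>S. v k * (A j k / P j))\<^sup>2)"
    and gram: "\<And>k l. k \<in> S \<Longrightarrow> l \<in> S \<Longrightarrow>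
      \<bar>\<Sum>j\<in>D. (X j - P j) * (A j k / P j * (A j l / P j))\<bar> \<le> kap\<^sup>2 / 4"
    and \<eta>: "0 \<le> \<eta>" "4 * \<eta> < kap * Tm"
    and noise: "\<And>v. (\<Sum>j\<in>D. (X j - P j) * (\<Sum>k\<in>S. v k * (A j k / P j)))
        \<le> sqrt (\<Sum>j\<in>D. P j * (\<Sum>k\<in>S. v k * (A j k / P j))\<^sup>2) * \<eta>"
    and B: "0 \<le> B" "\<And>j k. j \<in> D \<Longrightarrow> k \<in> {..<K} - S \<Longrightarrow> A j k / P j \<le> B"
    and off: "\<And>k. k \<in> {..<K} - S \<Longrightarrow> (\<Sum>j\<in>D. (X j - P j) * (A j k / P j)) \<le> \<delta>"
    and gap: "\<And>k. k \<in> {..<K} - S \<Longrightarrow> \<delta> + 4 * B * \<eta> < (\<Sum>j\<in>{..<p} - D. A j k)"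
    and mle: "is_mle p K A X V"
  shows "supp K V \<subseteq> S"
proof -
  obtain U where loc: "local_mle X U" using local_mle_exists by blast
  have U: "U \<in> nbhd" using loc by (simp add: local_mle_def)
  let ?u = "mat_vec K A U"
  define w where "w j = (?u j - P j) / P j" for j
  have dev: "kap * (\<Sum>k\<in>S. \<bar>U k - T k\<bar>) \<le> 2 * \<eta>" "(\<Sum>j\<in>D. X j * (w j)\<^sup>2) \<le> 3 * \<eta>\<^sup>2"
    unfolding w_def by (rule local_mle_deviation[OF loc X(1) kap]; fact gram \<eta>(1) noise)+
  have "kap * (\<Sum>k\<in>S. \<bar>U k - T k\<bar>) < kap * (Tm / 2)" using dev(1) \<eta>(2) by simp
  then have interior: "(\<Sum>k\<in>S. \<bar>U k - T k\<bar>) < Tm / 2"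
    using kap(1) by (simp only: mult_less_cancel_left_pos)
  have Xw: "(\<Sum>j\<in>D. X j * \<bar>w j\<bar>) \<le> 2 * \<eta>"
  proof -
    have "(\<Sum>j\<in>D. X j * \<bar>w j\<bar>) = (\<Sum>j\<in>D. sqrt (X j) * (sqrt (X j) * \<bar>w j\<bar>))"
      using X(1) by (simp add: mult.assoc[symmetric])
    also have "\<dots> \<le> L2_set (\<lambda>j. sqrt (X j)) D * L2_set (\<lambda>j. sqrt (X j) * \<bar>w j\<bar>) D"
      by (rule order_trans[OF _ L2_set_mult_ineq]) (intro sum_mono, metis abs_ge_self abs_mult)
    also have "\<dots> = sqrt (\<Sum>j\<in>D. X j * (w j)\<^sup>2)"
      using X by (simp add: L2_set_def power_mult_distrib)
    also have "\<dots> \<le> sqrt ((2 * \<eta>)\<^sup>2)"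
      by (intro real_sqrt_le_mono order_trans[OF dev(2)]) (simp add: power_mult_distrib)
    also have "\<dots> = 2 * \<eta>" using \<eta>(1) by (intro real_sqrt_abs[THEN trans]) simp
    finally show ?thesis .
  qed
  show ?thesis
  proof (rule supp_mle_subset[OF X nbhd_simplex[OF U] nbhd_mat_vec(2)[OF U] _ _ mle])
    show "(\<Sum>j\<in>D. X j * (A j k / ?u j)) \<le> 1" if "k \<in> S" for k
      by (rule local_mle_score_on_support[OF loc interior X(3) that])
    show "(\<Sum>j\<in>D. X j * (A j k / ?u j)) < 1" if k: "k < K" "k \<notin> S" for k
    proof -
      have "(\<Sum>j\<in>D. X j * (A j k / ?u j)) \<le> (\<Sum>j\<in>D. X j * (A j k / P j) + 2 * B * (X j * \<bar>w j\<bar>))"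
      proof (rule sum_mono)
        fix j assume j: "j \<in> D"
        have half: "\<bar>w j\<bar> \<le> 1 / 2"
          using nbhd_mat_vec(1)[OF U j] P_pos[OF j] by (simp add: w_def pos_divide_le_eq)
        have u: "?u j = P j * (1 + w j)" using P_pos[OF j] by (simp add: w_def field_simps)
        have "1 \<le> (1 + 2 * \<bar>w j\<bar>) * (1 + w j)"
        proof (cases "0 \<le> w j")
          case False
          have "0 \<le> \<bar>w j\<bar> * (1 - 2 * \<bar>w j\<bar>)" using half by simp
          then show ?thesis using False by (simp add: algebra_simps)
        qed (simp add: algebra_simps)
        then have "1 / (1 + w j) \<le> 1 + 2 * \<bar>w j\<bar>"
          using half by (subst pos_divide_le_eq) (auto simp: abs_le_iff)
        then have "A j k / P j * (1 / (1 + w j)) \<le> A j k / P j * (1 + 2 * \<bar>w j\<bar>)"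
          by (rule mult_left_mono) (rule ratio_nonneg[OF j k(1)])
        then have "A j k / ?u j \<le> A j k / P j + 2 * (A j k / P j) * \<bar>w j\<bar>"
          by (simp add: u distrib_left add_divide_distrib mult_ac)
        also have "\<dots> \<le> A j k / P j + 2 * B * \<bar>w j\<bar>"
          using B(2)[OF j, of k] k by (intro add_left_mono mult_right_mono) auto
        finally have "A j k / ?u j \<le> A j k / P j + 2 * B * \<bar>w j\<bar>" .
        from mult_left_mono[OF this X(1)[of j]]
        show "X j * (A j k / ?u j) \<le> X j * (A j k / P j) + 2 * B * (X j * \<bar>w j\<bar>)"
          by (simp only: distrib_left mult_ac)
      qed
      also have "\<dots> = (\<Sum>j\<in>D. (X j - P j) * (A j k / P j)) + (\<Sum>j\<in>D. P j * (A j k / P j)) + 2 * B * (\<Sum>j\<in>D. X j * \<bar>w j\<bar>)"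
        by (simp only: sum.distrib sum_distrib_left[symmetric] left_diff_distrib sum_subtractf)
      also have "(\<Sum>j\<in>D. P j * (A j k / P j)) = (\<Sum>j\<in>D. A j k)"
        by (rule sum.cong) (auto dest: P_pos)
      also have "(\<Sum>j\<in>D. A j k) = 1 - (\<Sum>j\<in>{..<p} - D. A j k)"
        using off_mass_eq[OF k(1)] by simp
      also have "2 * B * (\<Sum>j\<in>D. X j * \<bar>w j\<bar>) \<le> 2 * B * (2 * \<eta>)"
        using Xw B(1) by (intro mult_left_mono) auto
      finally show ?thesis using off[of k] gap[of k] k by simp
    qed
  qed
qed

section \<open>Support recovery\<close>

text \<open>
  The Gram event is used at level \<open>3 L\<close> because the union bound ranges over \<open>s\<^sup>2\<close> pairs and has to leave
  a factor \<open>1 / (s \<or> n)\<close>.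
\<close>

lemma gram_threshold_le:
  assumes N: "0 < N" and L: "0 \<le> L" and kap: "0 < kap" "kap \<le> 1"
    and q: "L / real N \<le> kap ^ 4 * Tm ^ 3 / 400"
  shows "2 * sqrt ((1 / Tm) ^ 3 * (3 * L) / real N) + (1 / Tm)\<^sup>2 * (3 * L) / real N \<le> kap\<^sup>2 / 4"
proof -
  have q3: "(1 / Tm) ^ 3 * (3 * L) / real N \<le> 3 * kap ^ 4 / 400"
    using mult_left_mono[OF q, of "3 * (1 / Tm) ^ 3"] Tm_pos by (simp add: field_simps)
  also have "\<dots> \<le> (kap\<^sup>2 / 10)\<^sup>2"
    by (simp add: power_divide power_mult[symmetric])
  finally have "sqrt ((1 / Tm) ^ 3 * (3 * L) / real N) \<le> kap\<^sup>2 / 10"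
    by (intro real_le_lsqrt) auto
  moreover have "(1 / Tm)\<^sup>2 * (3 * L) / real N \<le> kap\<^sup>2 / 100"
  proof -
    have "(1 / Tm)\<^sup>2 * (3 * L) / real N = Tm * ((1 / Tm) ^ 3 * (3 * L) / real N)"
      using Tm_pos by (simp add: field_simps power2_eq_square power3_eq_cube)
    also have "\<dots> \<le> 1 * (3 * kap ^ 4 / 400)"
      using q3 Tm_pos Tm_le_1 L by (intro mult_mono) auto
    finally have "(1 / Tm)\<^sup>2 * (3 * L) / real N \<le> 3 * kap ^ 4 / 400" by simp
    moreover have "kap ^ 4 \<le> kap\<^sup>2"
      using kap by (intro power_decreasing) auto
    ultimately show ?thesis using zero_le_power2[of kap] by linarith
  qed
  ultimately show ?thesis using zero_le_power2[of kap] by linarith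
qed

text \<open>
  The sample size condition makes \<open>sqrt (t / N)\<close> at most \<open>\<kappa> Tm / 20\<close>, so the linear Bernstein term is of
  lower order. The second bound uses \<open>card S * Tm \<le> 1\<close> and places the candidate inside its ball.
\<close>

lemma noise_threshold_le:
  assumes N: "0 < N" and t: "0 \<le> t" and kap: "0 < kap" "kap \<le> 1"
    and q: "t / real N \<le> kap ^ 4 * Tm ^ 3 / 400"
  shows "2 * sqrt (2 * t / real N) + 1 / (kap * Tm) * (2 * t) / real N \<le> 3 * sqrt (t / real N)"
    and "4 * (sqrt (real (card S)) * (3 * sqrt (t / real N))) < kap * Tm"
proof -
  define y where "y = sqrt (t / real N)"
  have y: "0 \<le> y" "y\<^sup>2 = t / real N" using t by (simp_all add: y_def)
  have kT: "0 < kap * Tm" using kap Tm_pos by simp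
  have "kap ^ 4 * Tm ^ 3 \<le> kap\<^sup>2 * Tm\<^sup>2"
    using kap Tm_pos Tm_le_1 by (intro mult_mono power_decreasing) auto
  then have "y\<^sup>2 \<le> (kap * Tm / 20)\<^sup>2"
    using q unfolding y by (simp add: power_divide power_mult_distrib)
  then have y20: "y \<le> kap * Tm / 20"
    by (rule power2_le_imp_le) (use kT in simp)
  have "sqrt 2 \<le> (142 / 100 :: real)"
    by (rule real_le_lsqrt) (auto simp: power2_eq_square)
  then have "sqrt (2 * t / real N) \<le> 142 / 100 * y"
    using mult_right_mono[of "sqrt 2" "142 / 100" y] y(1)
    by (simp add: y_def real_sqrt_mult[symmetric])
  moreover have "1 / (kap * Tm) * (2 * t) / real N \<le> y / 10"
  proof -
    have "1 / (kap * Tm) * (2 * t) / real N = 2 / (kap * Tm) * (y * y)"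
      using y(2) by (simp add: power2_eq_square)
    also have "\<dots> \<le> 2 / (kap * Tm) * (y * (kap * Tm / 20))"
      using y y20 kT by (intro mult_left_mono) auto
    also have "\<dots> = y / 10" using kap(1) Tm_pos by (simp add: field_simps)
    finally show ?thesis .
  qed
  ultimately show "2 * sqrt (2 * t / real N) + 1 / (kap * Tm) * (2 * t) / real N \<le> 3 * sqrt (t / real N)"
    using y(1) unfolding y_def[symmetric] by linarith
  have "(sqrt (real (card S)) * y)\<^sup>2 = real (card S) * y\<^sup>2" by (simp add: power_mult_distrib)
  also have "\<dots> \<le> real (card S) * (kap ^ 4 * Tm ^ 3 / 400)"
    using q y by (intro mult_left_mono) auto
  also have "\<dots> = real (card S) * Tm * (kap ^ 4 * Tm\<^sup>2 / 400)"
    by (simp add: power2_eq_square power3_eq_cube)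
  also have "\<dots> \<le> 1 * (kap\<^sup>2 * Tm\<^sup>2 / 400)"
    using card_S_Tm kap Tm_pos by (intro mult_mono divide_right_mono mult_right_mono power_decreasing) auto
  also have "\<dots> = (kap * Tm / 20)\<^sup>2" by (simp add: power_divide power_mult_distrib)
  finally have "sqrt (real (card S)) * y \<le> kap * Tm / 20"
    by (rule power2_le_imp_le) (use kT in simp)
  then show "4 * (sqrt (real (card S)) * (3 * sqrt (t / real N))) < kap * Tm"
    using kT by (simp add: y_def)
qed

text \<open>
  The separation condition enters through two of its consequences, with \<open>r = \<rho> / 20\<close> and
  \<open>B = \<xi> / Tm\<close>: \<open>sqrt (B log K / N) \<le> r\<close> controls the score at the truth, and
  \<open>B sqrt (s log K / N) \<le> r\<close>, which uses \<open>\<kappa> \<le> 1\<close>, controls the error of the candidate.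
\<close>

lemma prob_supp_mle_subset:
  fixes M N :: nat and kap :: real
  assumes N: "0 < N" and M: "card S \<le> M" "1 < M" and K: "card S < K" "1 < K"
    and kap: "0 < kap" "kap \<le> 1"
      "\<And>v. kap * (\<Sum>k\<in>S. \<bar>v k\<bar>) \<le> sqrt (\<Sum>j\<in>D. P j * (\<Sum>k\<in>S. v k * (A j k / P j))\<^sup>2)"
    and mle: "\<And>X. X \<in> set_pmf (freq_pmf p N P) \<Longrightarrow> is_mle p K A X (That X)"
    and size: "400 * ln (real M) / (kap ^ 4 * Tm ^ 3) \<le> real N"
    and sep: "(1 / kap * sqrt (xi p K A T * real (card S) / Tm) + 1) * sqrt (xi p K A T * ln (real K) / (Tm * real N))
        \<le> 1 / 20 * Min (off_mass ` ({..<K} - S))"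
  shows "1 - 4 / real M - 4 / real K \<le> measure_pmf.prob (freq_pmf p N P) {X. supp K (That X) \<subseteq> S}"
proof -
  define L where "L = ln (real M)"
  define LK where "LK = ln (real K)"
  define t where "t = min L LK"
  have L: "0 < L" and LK: "0 < LK" using M K by (simp_all add: L_def LK_def)
  have t: "0 < t" "t \<le> L" "t \<le> LK" using L LK by (auto simp: t_def)
  define x where "x = xi p K A T"
  define B where "B = x / Tm"
  define \<rho> where "\<rho> = Min (off_mass ` ({..<K} - S))"
  define r where "r = \<rho> / 20"
  define s where "s = real (card S)"
  have Nr: "0 < real N" using N by simp
  have S_neq: "S \<noteq> {..<K}"
  proof
    assume "S = {..<K}"
    then have "card S = card {..<K}" by (rule arg_cong)
    then show False using K(1) by simp
  qed
  have off_ne: "{..<K} - S \<noteq> {}" using S_neq supp_subset[of K T] by blast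
  have B0: "0 \<le> B" using xi_nonneg[OF S_neq] Tm_pos by (simp add: B_def x_def)
  have ratio_B: "A j k / P j \<le> B" if "j \<in> D" "k \<in> {..<K} - S" for j k
    using ratio_le_off_support that by (auto simp: B_def x_def)
  have rho_le: "\<rho> \<le> off_mass k" if "k \<in> {..<K} - S" for k
    unfolding \<rho>_def by (rule Min_le) (use that in auto)
  have rho_1: "\<rho> \<le> 1"
  proof -
    obtain k where k: "k \<in> {..<K} - S" using off_ne by blast
    have "0 \<le> (\<Sum>j\<in>D. A j k)" using k A_nonneg D_less by (intro sum_nonneg) auto
    then show ?thesis using rho_le[OF k] off_mass_eq[of k] k by simp
  qed
  define a where "a = sqrt (B * LK / real N)"
  have a0: "0 \<le> a" using B0 LK by (simp add: a_def)
  have sep': "(1 / kap * sqrt (B * s) + 1) * a \<le> r"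
    using sep by (simp add: B_def a_def r_def \<rho>_def x_def LK_def s_def)
  have sB: "0 \<le> sqrt (B * s)" using B0 by (simp add: s_def)
  have "0 \<le> 1 / kap * sqrt (B * s) * a" using kap(1) sB a0 by simp
  then have a_r: "a \<le> r" using sep' by (simp add: distrib_right)
  have sBa: "sqrt (B * s) * a \<le> r"
  proof -
    have "1 * (sqrt (B * s) * a) \<le> 1 / kap * (sqrt (B * s) * a)"
      using kap sB a0 by (intro mult_right_mono) auto
    then show ?thesis using sep' a0 by (simp add: distrib_right)
  qed
  \<comment> \<open>If \<open>\<rho>\<close> were not positive, separation would force \<open>\<xi> = 0\<close>; but then the
    columns outside \<open>S\<close> vanish on \<open>D\<close>, and \<open>\<rho> = 1\<close>.\<close>
  have r_pos: "0 < r"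
  proof (rule ccontr)
    assume "\<not> 0 < r"
    then have "a = 0" using a0 a_r by simp
    then have "B = 0" using LK Nr by (simp add: a_def)
    have "off_mass k = 1" if k: "k \<in> {..<K} - S" for k
    proof -
      have "A j k = 0" if j: "j \<in> D" for j
        using ratio_B[OF j k] P_pos[OF j] A_nonneg[OF D_less[OF j], of k] k \<open>B = 0\<close>
        by (simp add: divide_le_0_iff)
      then show ?thesis using off_mass_eq[of k] k by simp
    qed
    then have "off_mass ` ({..<K} - S) = (\<lambda>_. 1) ` ({..<K} - S)"
      by (intro image_cong) auto
    then have "\<rho> = 1" using off_ne by (simp add: \<rho>_def)
    then show False using \<open>\<not> 0 < r\<close> by (simp add: r_def)
  qed
  have q: "L / real N \<le> kap ^ 4 * Tm ^ 3 / 400"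
    using size kap(1) Tm_pos Nr by (simp add: L_def field_simps)
  have qt: "t / real N \<le> kap ^ 4 * Tm ^ 3 / 400"
    by (rule order_trans[OF divide_right_mono[OF t(2)] q]) simp

  define \<eta> where "\<eta> = sqrt s * (3 * sqrt (t / real N))"
  \<comment> \<open>Bernstein's inequality needs a positive bound on the ratios, while \<open>B\<close> may be 0.
    \<open>B'\<close> is the largest bound that the separation condition allows.\<close>
  define B' where "B' = r\<^sup>2 * real N / LK"
  have B'0: "0 < B'" using r_pos Nr LK by (simp add: B'_def)
  have BB': "B \<le> B'"
  proof -
    have "a\<^sup>2 \<le> r\<^sup>2" using a_r a0 by (rule power_mono)
    then show ?thesis using B0 LK Nr by (simp add: a_def B'_def field_simps)
  qed
  define \<delta> where "\<delta> = 2 * sqrt (B' * (2 * LK) / real N) + B' * (2 * LK) / real N"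
  have \<delta>: "\<delta> \<le> 3 * r"
  proof -
    have B'r: "B' * (2 * LK) / real N = 2 * r\<^sup>2" using LK Nr by (simp add: B'_def)
    have "sqrt 2 \<le> (142 / 100 :: real)"
      by (rule real_le_lsqrt) (auto simp: power2_eq_square)
    from mult_right_mono[OF this, of r] have "sqrt (2 * r\<^sup>2) \<le> 142 / 100 * r"
      using r_pos by (simp add: real_sqrt_mult)
    moreover have "r * r \<le> 1 / 20 * r"
      using r_pos rho_1 by (intro mult_right_mono) (auto simp: r_def)
    ultimately show ?thesis
      using r_pos unfolding \<delta>_def B'r power2_eq_square by linarith
  qed
  have B\<eta>: "B * \<eta> \<le> 3 * r"
  proof -
    have "B * (sqrt s * sqrt (t / real N)) = sqrt (B * s) * sqrt (B * t / real N)"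
      using B0 by (simp add: real_sqrt_mult real_sqrt_divide)
    also have "\<dots> \<le> sqrt (B * s) * a"
      unfolding a_def using sB B0 t(3) Nr
      by (intro mult_left_mono real_sqrt_le_mono divide_right_mono) auto
    finally show ?thesis using sBa by (simp add: \<eta>_def)
  qed

  define E1 where "E1 = {X. \<exists>k\<in>S. \<exists>l\<in>S. 2 * sqrt ((1 / Tm) ^ 3 * (3 * L) / real N) + (1 / Tm)\<^sup>2 * (3 * L) / real N
        < \<bar>\<Sum>j\<in>D. (X j - P j) * (A j k / P j * (A j l / P j))\<bar>}"
  define E2 where "E2 = {X. \<exists>v. sqrt (\<Sum>j\<in>D. P j * (\<Sum>k\<in>S. v k * (A j k / P j))\<^sup>2)
           * (sqrt (real (card S)) * (2 * sqrt (2 * t / real N) + 1 / (kap * Tm) * (2 * t) / real N))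
        < (\<Sum>j\<in>D. (X j - P j) * (\<Sum>k\<in>S. v k * (A j k / P j)))}"
  define E3 where "E3 = {X. \<exists>k\<in>{..<K} - S. \<delta> < (\<Sum>j\<in>D. (X j - P j) * (A j k / P j))}"
  let ?M = "freq_pmf p N P"
  let ?G = "{X. supp K (That X) \<subseteq> S}"
  have good: "supp K (That X) \<subseteq> S" if X: "X \<in> set_pmf ?M" "X \<notin> E1" "X \<notin> E2" "X \<notin> E3" for X
  proof (rule supp_mle_subset_of_deviations[where kap = kap and \<eta> = \<eta> and B = B and \<delta> = \<delta> and X = X])
    show "0 \<le> X j" "j \<notin> D \<Longrightarrow> X j = 0" "(\<Sum>j\<in>D. X j) = 1" for j
      using set_freq_pmf[OF P_simplex N X(1)] by auto
    show "\<bar>\<Sum>j\<in>D. (X j - P j) * (A j k / P j * (A j l / P j))\<bar> \<le> kap\<^sup>2 / 4" if "k \<in> S" "l \<in> S" for k l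
    proof -
      have "\<bar>\<Sum>j\<in>D. (X j - P j) * (A j k / P j * (A j l / P j))\<bar>
          \<le> 2 * sqrt ((1 / Tm) ^ 3 * (3 * L) / real N) + (1 / Tm)\<^sup>2 * (3 * L) / real N"
        using X(2) that unfolding E1_def not_less[symmetric] by blast
      also have "\<dots> \<le> kap\<^sup>2 / 4"
        by (rule gram_threshold_le[OF N _ kap(1,2) q]) (use L in simp)
      finally show ?thesis .
    qed
    show "0 \<le> \<eta>" using t(1) by (simp add: \<eta>_def s_def)
    show "4 * \<eta> < kap * Tm"
      unfolding \<eta>_def s_def by (rule noise_threshold_le(2)[OF N _ kap(1,2) qt]) (use t in simp)
    show "(\<Sum>j\<in>D. (X j - P j) * (\<Sum>k\<in>S. v k * (A j k / P j)))
        \<le> sqrt (\<Sum>j\<in>D. P j * (\<Sum>k\<in>S. v k * (A j k / P j))\<^sup>2) * \<eta>" for v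
    proof -
      let ?Q = "\<Sum>j\<in>D. P j * (\<Sum>k\<in>S. v k * (A j k / P j))\<^sup>2"
      have "(\<Sum>j\<in>D. (X j - P j) * (\<Sum>k\<in>S. v k * (A j k / P j)))
          \<le> sqrt ?Q * (sqrt (real (card S)) * (2 * sqrt (2 * t / real N) + 1 / (kap * Tm) * (2 * t) / real N))"
        using X(3) unfolding E2_def not_less[symmetric] by blast
      also have "\<dots> \<le> sqrt ?Q * \<eta>"
        unfolding \<eta>_def s_def
        using noise_threshold_le(1)[OF N _ kap(1,2) qt] t(1) P_pos
        by (intro mult_left_mono) (auto intro!: sum_nonneg mult_nonneg_nonneg simp: less_imp_le)
      finally show ?thesis .
    qed
    show "(\<Sum>j\<in>D. (X j - P j) * (A j k / P j)) \<le> \<delta>" if "k \<in> {..<K} - S" for k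
      using X(4) that unfolding E3_def not_less[symmetric] by blast
    show "\<delta> + 4 * B * \<eta> < off_mass k" if "k \<in> {..<K} - S" for k
    proof -
      have "\<delta> + 4 * (B * \<eta>) \<le> 15 * r" using \<delta> B\<eta> by simp
      also have "\<dots> < \<rho>" using r_pos by (simp add: r_def)
      finally show ?thesis using rho_le[OF that] by (simp add: mult.assoc)
    qed
  qed (use kap B0 ratio_B mle[OF X(1)] in auto)
  have expL: "exp (- (real m * ln (real k))) = 1 / real k ^ m" if "1 < k" for k m :: nat
    using that by (simp add: exp_minus exp_of_nat_mult inverse_eq_divide)
  have S_M: "s \<le> real M" "s \<le> real K" "0 \<le> s" using M K by (auto simp: s_def)
  have p1: "measure_pmf.prob ?M E1 \<le> 2 / real M"
  proof -
    have "measure_pmf.prob ?M E1 \<le> 2 * s\<^sup>2 * exp (- (3 * L))"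
      unfolding E1_def s_def by (rule prob_gram[OF N]) (use L in simp)
    also have "exp (- (3 * L)) = 1 / real M ^ 3" using expL[OF M(2), of 3] by (simp add: L_def)
    also have "2 * s\<^sup>2 * (1 / real M ^ 3) \<le> 2 * (real M)\<^sup>2 * (1 / real M ^ 3)"
      using S_M by (intro mult_right_mono mult_left_mono power_mono) auto
    finally show ?thesis using M by (simp add: power2_eq_square power3_eq_cube)
  qed
  have p2: "measure_pmf.prob ?M E2 \<le> 2 / real M + 2 / real K"
  proof -
    have "measure_pmf.prob ?M E2 \<le> 2 * s * exp (- (2 * t))"
      unfolding E2_def s_def by (rule prob_noise[OF N _ kap(1,3)]) (use t in simp)
    also have "\<dots> \<le> 2 / real M + 2 / real K"
    proof (cases "L \<le> LK")
      case True
      then have "exp (- (2 * t)) = 1 / (real M)\<^sup>2" using expL[OF M(2), of 2] by (simp add: t_def L_def)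
      then have "2 * s * exp (- (2 * t)) \<le> 2 * real M * (1 / (real M)\<^sup>2)"
        using S_M by (simp add: divide_right_mono)
      also have "\<dots> = 2 / real M" using M by (simp add: power2_eq_square)
      finally show ?thesis by (simp add: add_increasing2)
    next
      case False
      then have "exp (- (2 * t)) = 1 / (real K)\<^sup>2" using expL[OF K(2), of 2] by (simp add: t_def LK_def)
      then have "2 * s * exp (- (2 * t)) \<le> 2 * real K * (1 / (real K)\<^sup>2)"
        using S_M by (simp add: divide_right_mono)
      also have "\<dots> = 2 / real K" using K by (simp add: power2_eq_square)
      finally show ?thesis by (simp add: add_increasing)
    qed
    finally show ?thesis .
  qed
  have p3: "measure_pmf.prob ?M E3 \<le> 1 / real K"
  proof -
    have "measure_pmf.prob ?M E3 \<le> real K * exp (- (2 * LK))"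
      unfolding E3_def \<delta>_def
      by (rule prob_off_support[OF N _ B'0]) (use LK ratio_B BB' in \<open>auto intro: order_trans\<close>)
    also have "exp (- (2 * LK)) = 1 / (real K)\<^sup>2" using expL[OF K(2), of 2] by (simp add: LK_def)
    finally show ?thesis using K by (simp add: power2_eq_square)
  qed
  have "1 - measure_pmf.prob ?M ?G = measure_pmf.prob ?M (- ?G)"
    using measure_pmf.prob_compl[of ?G ?M] by (simp add: Compl_eq_Diff_UNIV)
  also have "\<dots> \<le> measure_pmf.prob ?M (E1 \<union> E2 \<union> E3)"
    by (rule measure_pmf.finite_measure_mono_AE) (use good in \<open>auto simp: AE_measure_pmf_iff\<close>)
  also have "\<dots> \<le> measure_pmf.prob ?M (E1 \<union> E2) + measure_pmf.prob ?M E3"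
    by (rule measure_Un_le) auto
  also have "\<dots> \<le> measure_pmf.prob ?M E1 + measure_pmf.prob ?M E2 + measure_pmf.prob ?M E3"
    by (intro add_right_mono measure_Un_le) auto
  also have "\<dots> \<le> 4 / real M + 4 / real K"
  proof -
    have "0 \<le> 1 / real K" by simp
    with p1 p2 p3 show ?thesis by linarith
  qed
  finally show ?thesis by simp
qed

end

theorem theorem5:
  shows "\<exists>C>0. \<exists>c>0. \<forall>(p::nat) (K::nat) (N::nat) (n::nat) (s::nat)
      (A :: nat \<Rightarrow> nat \<Rightarrow> real) (T :: nat \<Rightarrow> real) (That :: (nat \<Rightarrow> real) \<Rightarrow> (nat \<Rightarrow> real)).
    let P = mat_vec K A T;
        kap = kappa (J_lower p N P) K A s;
        x = xi p K A T;
        Tm = T_min K T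
    in
      K < p \<longrightarrow> 1 \<le> K \<longrightarrow> 1 \<le> N \<longrightarrow> 1 \<le> n \<longrightarrow> 1 \<le> s \<longrightarrow> s < K \<longrightarrow>
      (\<forall>k<K. (\<lambda>j. A j k) \<in> simplex_vecs p) \<longrightarrow>
      T \<in> simplex_vecs K \<longrightarrow> card (supp K T) = s \<longrightarrow>
      (\<forall>X\<in>set_pmf (freq_pmf p N P). is_mle p K A X (That X)) \<longrightarrow>
      kap > 0 \<longrightarrow>
      real N \<ge> C * ln (real (max s n)) / (kap ^ 4 * Tm ^ 3) \<longrightarrow>
      (1 / kap * sqrt (x * real s / Tm) + 1) * sqrt (x * ln (real K) / (Tm * real N))
        \<le> c * Min ((\<lambda>k. \<Sum>j\<in>{..<p} - J_upper p P. A j k) ` ({..<K} - supp K T)) \<longrightarrow>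
      measure_pmf.prob (freq_pmf p N P) {X. supp K (That X) \<subseteq> supp K T}
        \<ge> 1 - 2 / real p - 4 / real (max s n) - 4 / real K"
proof (rule exI[of _ 400], rule conjI, simp, rule exI[of _ "1 / 20"], rule conjI, simp,
    unfold Let_def, intro allI impI)
  fix p K N n s :: nat and A :: "nat \<Rightarrow> nat \<Rightarrow> real" and T :: "nat \<Rightarrow> real"
    and That :: "(nat \<Rightarrow> real) \<Rightarrow> (nat \<Rightarrow> real)"
  let ?P = "mat_vec K A T"
  let ?kap = "kappa (J_lower p N ?P) K A s"
  let ?prob = "measure_pmf.prob (freq_pmf p N ?P) {X. supp K (That X) \<subseteq> supp K T}"
  assume K: "K < p" "1 \<le> K" and N: "1 \<le> N" and s: "1 \<le> s" "s < K"
    and A: "\<forall>k<K. (\<lambda>j. A j k) \<in> simplex_vecs p" and T: "T \<in> simplex_vecs K"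
    and card: "card (supp K T) = s"
    and mle: "\<forall>X\<in>set_pmf (freq_pmf p N ?P). is_mle p K A X (That X)"
    and kap: "0 < ?kap"
    and size: "400 * ln (real (max s n)) / (?kap ^ 4 * T_min K T ^ 3) \<le> real N"
    and sep: "(1 / ?kap * sqrt (xi p K A T * real s / T_min K T) + 1) * sqrt (xi p K A T * ln (real K) / (T_min K T * real N))
        \<le> 1 / 20 * Min ((\<lambda>k. \<Sum>j\<in>{..<p} - J_upper p ?P. A j k) ` ({..<K} - supp K T))"
  interpret topic_model p K A T
    using A T by unfold_locales auto
  have sub: "J_lower p N ?P \<subseteq> J_upper p ?P" using J_lower_subset K by simp
  show "1 - 2 / real p - 4 / real (max s n) - 4 / real K \<le> ?prob"
  \<comment> \<open>For \<open>max s n = 1\<close> the sample size condition is void because \<open>ln 1 = 0\<close>, but the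
    claimed lower bound is negative.\<close>
  proof (cases "max s n = 1")
    case True
    have "0 \<le> 2 / real p" "0 \<le> 4 / real K" by simp_all
    then have "1 - 2 / real p - 4 / real (max s n) - 4 / real K \<le> 0"
      by (simp only: True of_nat_1)
    also have "0 \<le> ?prob" by simp
    finally show ?thesis .
  next
    case False
    have "1 - 4 / real (max s n) - 4 / real K \<le> ?prob"
    proof (rule prob_supp_mle_subset[where kap = ?kap])
      show "?kap * (\<Sum>k\<in>S. \<bar>v k\<bar>) \<le> sqrt (\<Sum>j\<in>D. P j * (\<Sum>k\<in>S. v k * (A j k / P j))\<^sup>2)" for v
        by (rule kappa_norm1_le_L2[OF sub]) (simp add: card)
      show "?kap \<le> 1" by (rule kappa_le_1[OF sub]) (simp add: card)
      show "(1 / ?kap * sqrt (xi p K A T * real (card S) / Tm) + 1) * sqrt (xi p K A T * ln (real K) / (Tm * real N))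
          \<le> 1 / 20 * Min (off_mass ` ({..<K} - S))"
        unfolding card by (rule sep)
      show "400 * ln (real (max s n)) / (?kap ^ 4 * Tm ^ 3) \<le> real N" by (rule size)
      show "is_mle p K A X (That X)" if "X \<in> set_pmf (freq_pmf p N P)" for X
        using mle that by blast
    qed (use False N s card kap in auto)
    moreover have "0 \<le> 2 / real p" by simp
    ultimately show ?thesis by linarith
  qed
qed

end
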